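(* Suppose that $F:\mathcal V\to\mathbb R\cup\{+\infty\}$ and $G:\mathcal U\to\mathbb R\cup\{+\infty\}$ are proper lower semicontinuous convex functions, and $H:\mathcal V\to\mathbb R$ is a differentiable convex function with locally Lipschitz continuous gradient. Suppose, in addition, that the linesearch procedure $\mathtt{LS}$ satisfies Assumption A, that Assumption B holds, and that there exists a saddle point of the problem $\min_{u\in\mathcal U}\max_{v\in\mathcal V}\Psi(u,v)$. Then the sequence $(u^k,v^k)$ generated by the Primal-dual algorithm with linesearch converges to a saddle point $(\hat u,\hat v)$ of this problem, and $\big(\hat{\mathcal G}_{(\hat u,\hat v)}(u^k,v^k)\big)$ converges to $0$.
   Context: Setting. $\mathcal U,\mathcal V$ are finite-dimensional real Hilbert spaces, $K:\mathcal U\to\mathcal V$ is a nonzero linear operator with adjoint $K^*$ and operator norm $\|K\|$, and $$\Psi(u,v)=\langle Ku,v\rangle+G(u)-F(v)-H(v).$$ A saddle point is a pair $(\hat u,\hat v)\in\mathcal U\times\mathcal V$ with $\Psi(\hat u,v)\le\Psi(\hat u,\hat v)\le\Psi(u,\hat v)$ for all $(u,v)\in\mathcal U\times\mathcal V$; equivalently, $\hat u\in\operatorname{dom}G$, $\hat v\in\operatorname{dom}F$ and, for all $u,v$, $$\hat P_{(\hat u,\hat v)}(u):=G(u)-G(\hat u)+\langle K^*\hat v,u-\hat u\rangle\ge0,\qquad \hat D_{(\hat u,\hat v)}(v):=(F+H)(v)-(F+H)(\hat v)-\langle K\hat u,v-\hat v\rangle\ge0.$$ The primal-dual gap is $\hat{\mathcal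 G}_{(\hat u,\hat v)}(u,v)=\hat P_{(\hat u,\hat v)}(u)+\hat D_{(\hat u,\hat v)}(v)$. For a proper lsc convex $\phi$ and $\tau>0$, $\operatorname{prox}_{\tau\phi}(x)=\arg\min_y\{\phi(y)+\frac1{2\tau}\|y-x\|^2\}$. Primal-dual algorithm with linesearch. Choose $u^0\in\mathcal U$, $v^1\in\mathcal V$, a set of parameters $\mathtt{param}$ containing $\beta>0$ and $\delta_L\in(0,1)$, and parameters $\tau_0>0$, $\gamma\in(0,1)$, $\delta_K\in(0,1)$ with $\delta_K+\delta_L<1$. Set $\theta_0=1$. For $k=1,2,\dots$: Step 1: $u^k=\operatorname{prox}_{\tau_{k-1}G}(u^{k-1}-\tau_{k-1}K^*v^k)$. Step 2: choose $\alpha_k\in[1,\sqrt{1+\gamma\theta_{k-1}}]$, put $\tau_{k(0)}=\min\Big\{\frac{\sqrt{\delta_K}}{\sqrt\beta\,\|K\|},\ \tau_{k-1}\alpha_k\Big\}$, and compute $(\tau_k,v^{k+1})=\mathtt{LS}(\mathtt{param},\tau_{k(0)},\tau_{k-1},u^{k-1},u^k,v^k)$, where $$\theta_k=\tau_k\tau_{k-1}^{-1},\quad \overline u^k=u^k+\theta_k(u^k-u^{k-1}),\quad v^{k+1}=\operatorname{prox}_{\beta\tau_kF}\big(v^k+\beta\tau_k[K\overline u^k-\nabla H(v^k)]\big).$$ Assumption A (abstract linesearch). Whenever $\mathtt{LS}$ is given an input $(\mathtt{param},\tau_{\rm init},\tau,u^-,u,v)$ with $\tau_{\rm init},\tau\in(0,+\infty)$,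 $u^-,u\in\mathcal U$, $v\in\mathcal V$, its output $(\tau^+,v^+)\in(0,+\infty)\times\mathcal V$ satisfies: (i) $\tau^+\le\tau_{\rm init}$; (ii) for the parameters $\beta>0$ and $\delta_L\in(0,1)$ in $\mathtt{param}$, $\tau^+\big(H(v^+)-H(v)-\langle\nabla H(v),v^+-v\rangle\big)\le\frac{\delta_L}{2\beta}\|v^+-v\|^2$. Assumption B. The sequence $(\tau_k)$ generated by the algorithm implemented with $\mathtt{LS}$ is separated from $0$, i.e. there is $c>0$ with $\tau_k\ge c$ for all $k$. *)

theory Defs
  imports "HOL-Analysis.Analysis"
begin

text \<open>Functions with values in \<open>\<real> \<union> {+\<infinity>}\<close> are functions into \<^typ>\<open>ereal\<close> that avoid \<open>-\<infinity>\<close>;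
  this is part of \<open>proper\<close>.\<close>

definition proper :: "('a \<Rightarrow> ereal) \<Rightarrow> bool" where
  "proper f \<longleftrightarrow> (\<forall>x. f x \<noteq> -\<infinity>) \<and> (\<exists>x. f x \<noteq> \<infinity>)"

definition lsc :: "('a::topological_space \<Rightarrow> ereal) \<Rightarrow> bool" where
  "lsc f \<longleftrightarrow> (\<forall>x. f x \<le> Liminf (at x) f)"

definition ereal_convex :: "('a::real_vector \<Rightarrow> ereal) \<Rightarrow> bool" where
  "ereal_convex f \<longleftrightarrow>
     (\<forall>x y. \<forall>s\<ge>0. \<forall>t\<ge>0. s + t = 1 \<longrightarrow>
        f (s *\<^sub>R x + t *\<^sub>R y) \<le> ereal s * f x + ereal t * f y)"

definition prox :: "real \<Rightarrow> ('a::real_inner \<Rightarrow> ereal) \<Rightarrow> 'a \<Rightarrow> 'a" where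
  "prox \<tau> \<phi> x = (ARG_MIN (\<lambda>y. \<phi> y + ereal (1 / (2 * \<tau>) * (norm (y - x))\<^sup>2)) y. True)"

definition gradient :: "('a::real_inner \<Rightarrow> real) \<Rightarrow> 'a \<Rightarrow> 'a" where
  "gradient h x = (THE D. GDERIV h x :> D)"

definition locally_lipschitz :: "('a::metric_space \<Rightarrow> 'b::metric_space) \<Rightarrow> bool" where
  "locally_lipschitz f \<longleftrightarrow> (\<forall>x. \<exists>r>0. \<exists>L. L-lipschitz_on (ball x r) f)"

text \<open>On \<^typ>\<open>ereal\<close>, \<open>\<infinity> - \<infinity> = \<infinity>\<close>, so \<open>\<Psi>(u,v) = \<infinity>\<close> whenever \<open>G u = \<infinity>\<close>. For proper \<open>F\<close> and \<open>G\<close> this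
  convention does not influence the notion of saddle point: a saddle point \<open>(uh, vh)\<close> satisfies
  \<open>uh \<in> dom G\<close> and \<open>vh \<in> dom F\<close>, and then only well-defined values are compared.\<close>

definition Psi ::
  "('u::real_inner \<Rightarrow> 'v::real_inner) \<Rightarrow> ('u \<Rightarrow> ereal) \<Rightarrow> ('v \<Rightarrow> ereal) \<Rightarrow> ('v \<Rightarrow> real)
    \<Rightarrow> 'u \<Rightarrow> 'v \<Rightarrow> ereal" where
  "Psi K G F H u v = ereal (K u \<bullet> v) + G u - F v - ereal (H v)"

definition saddle_point ::
  "('u::real_inner \<Rightarrow> 'v::real_inner) \<Rightarrow> ('u \<Rightarrow> ereal) \<Rightarrow> ('v \<Rightarrow> ereal) \<Rightarrow> ('v \<Rightarrow> real)
    \<Rightarrow> 'u \<Rightarrow> 'v \<Rightarrow> bool" where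
  "saddle_point K G F H uh vh \<longleftrightarrow>
     (\<forall>u v. Psi K G F H uh v \<le> Psi K G F H uh vh \<and> Psi K G F H uh vh \<le> Psi K G F H u vh)"

definition primal_gap ::
  "('u::real_inner \<Rightarrow> 'v::real_inner) \<Rightarrow> ('u \<Rightarrow> ereal) \<Rightarrow> 'u \<Rightarrow> 'v \<Rightarrow> 'u \<Rightarrow> ereal" where
  "primal_gap K G uh vh u = G u - G uh + ereal (adjoint K vh \<bullet> (u - uh))"

definition dual_gap ::
  "('u::real_inner \<Rightarrow> 'v::real_inner) \<Rightarrow> ('v \<Rightarrow> ereal) \<Rightarrow> ('v \<Rightarrow> real) \<Rightarrow> 'u \<Rightarrow> 'v \<Rightarrow> 'v \<Rightarrow> ereal" where
  "dual_gap K F H uh vh v =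
     (F v + ereal (H v)) - (F vh + ereal (H vh)) - ereal (K uh \<bullet> (v - vh))"

definition primal_dual_gap ::
  "('u::real_inner \<Rightarrow> 'v::real_inner) \<Rightarrow> ('u \<Rightarrow> ereal) \<Rightarrow> ('v \<Rightarrow> ereal) \<Rightarrow> ('v \<Rightarrow> real)
    \<Rightarrow> 'u \<Rightarrow> 'v \<Rightarrow> 'u \<Rightarrow> 'v \<Rightarrow> ereal" where
  "primal_dual_gap K G F H uh vh u v = primal_gap K G uh vh u + dual_gap K F H uh vh v"

text \<open>The parameters of a linesearch procedure: \<open>\<beta>\<close>, \<open>\<delta>\<^sub>L\<close> and, through the extension slot of the
  record, any further ones.\<close>

record ls_param =
  ls_beta :: real
  ls_delta :: real

type_synonym ('p, 'u, 'v) linesearch =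
  "'p ls_param_scheme \<Rightarrow> real \<Rightarrow> real \<Rightarrow> 'u \<Rightarrow> 'u \<Rightarrow> 'v \<Rightarrow> real \<times> 'v"

text \<open>The condition refers to the parameters with which the algorithm is run, since a procedure may
  impose its own constraints on the additional ones.\<close>

definition abstract_linesearch ::
  "('v::real_inner \<Rightarrow> real) \<Rightarrow> 'p ls_param_scheme \<Rightarrow> ('p, 'u, 'v) linesearch \<Rightarrow> bool" where
  "abstract_linesearch H param LS \<longleftrightarrow>
     (\<forall>\<tau>init \<tau> um u v \<tau>p vp.
        0 < \<tau>init \<longrightarrow> 0 < \<tau> \<longrightarrow> LS param \<tau>init \<tau> um u v = (\<tau>p, vp) \<longrightarrow>
          0 < \<tau>p \<and> \<tau>p \<le> \<tau>init \<and>
          \<tau>p * (H vp - H v - gradient H v \<bullet> (vp - v))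
            \<le> ls_delta param / (2 * ls_beta param) * (norm (vp - v))\<^sup>2)"

definition theta :: "(nat \<Rightarrow> real) \<Rightarrow> nat \<Rightarrow> real" where
  "theta \<tau> k = (if k = 0 then 1 else \<tau> k / \<tau> (k - 1))"

text \<open>The choice of \<open>\<alpha>\<^sub>k\<close> is left open, so the algorithm is a relation on its runs. The dual iterates
  start with \<open>v 1\<close>; the value \<open>v 0\<close> is never used.\<close>

definition pd_linesearch_run ::
  "('u::euclidean_space \<Rightarrow> 'v::euclidean_space) \<Rightarrow> ('u \<Rightarrow> ereal) \<Rightarrow> ('v \<Rightarrow> ereal) \<Rightarrow> ('v \<Rightarrow> real)
    \<Rightarrow> 'p ls_param_scheme \<Rightarrow> ('p, 'u, 'v) linesearch \<Rightarrow> real \<Rightarrow> real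
    \<Rightarrow> (nat \<Rightarrow> real) \<Rightarrow> (nat \<Rightarrow> real) \<Rightarrow> (nat \<Rightarrow> 'u) \<Rightarrow> (nat \<Rightarrow> 'v) \<Rightarrow> bool" where
  "pd_linesearch_run K G F H param LS \<gamma> \<delta>K \<alpha> \<tau> u v \<longleftrightarrow>
     (\<forall>k\<ge>1.
        u k = prox (\<tau> (k - 1)) G (u (k - 1) - \<tau> (k - 1) *\<^sub>R adjoint K (v k)) \<and>
        \<alpha> k \<in> {1 .. sqrt (1 + \<gamma> * theta \<tau> (k - 1))} \<and>
        (let \<beta> = ls_beta param;
             \<tau>init = min (sqrt \<delta>K / (sqrt \<beta> * onorm K)) (\<tau> (k - 1) * \<alpha> k);
             ubar = u k + theta \<tau> k *\<^sub>R (u k - u (k - 1))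
         in (\<tau> k, v (k + 1)) = LS param \<tau>init (\<tau> (k - 1)) (u (k - 1)) (u k) (v k) \<and>
            v (k + 1) = prox (\<beta> * \<tau> k) F (v k + (\<beta> * \<tau> k) *\<^sub>R (K ubar - gradient H (v k)))))"

end

theory Submission
  imports Defs
begin

text \<open>
  Fix a saddle point \<open>(uh, vh)\<close> and consider the energy

  \<open>|uh - u\<^sup>k|\<^sup>2 / 2 + |vh - v\<^sup>k|\<^sup>2 / (2 \<beta>) + \<tau>\<^sub>k\<^sub>-\<^sub>1 (1 + \<theta>\<^sub>k\<^sub>-\<^sub>1) P (u\<^sup>k\<^sup>-\<^sup>1)\<close>

  of the iterates, where \<open>P\<close> and \<open>D\<close> are the (nonnegative) primal and dual gap functions of
  \<open>(uh, vh)\<close>. The variational inequality of the primal prox step is used three times: for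
  \<open>u\<^sup>k\<^sup>+\<^sup>1\<close> against \<open>uh\<close>, and for \<open>u\<^sup>k\<close> against \<open>u\<^sup>k\<^sup>+\<^sup>1\<close> and against \<open>u\<^sup>k\<^sup>-\<^sup>1\<close>. Weighting the last two by \<open>\<theta>\<^sub>k\<close> and
  \<open>\<theta>\<^sub>k\<^sup>2\<close> makes the extrapolated point \<open>ubar\<close> appear, and adding the variational inequality of
  the dual prox step and the linesearch condition leaves \<open>- \<tau>\<^sub>k \<langle>K (u\<^sup>k\<^sup>+\<^sup>1 - ubar), v\<^sup>k\<^sup>+\<^sup>1 - v\<^sup>k\<rangle>\<close> as the only
  coupling term (\<open>pd_step_inequality\<close>). Because \<open>\<tau>\<^sub>k |K| \<le> sqrt (\<delta>K / \<beta>)\<close> and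
  \<open>\<delta>K + \<delta>L < 1\<close>, that term is absorbed by the squared increments
  (\<open>quadratic_form_coercive\<close>). The bound on \<open>\<alpha>\<^sub>k\<close> gives \<open>\<tau>\<^sub>k \<theta>\<^sub>k \<le> \<tau>\<^sub>k\<^sub>-\<^sub>1 (1 + \<theta>\<^sub>k\<^sub>-\<^sub>1)\<close>, so that the
  energy is nonincreasing, and it drops at each step by at least a multiple of the squared
  increments and of \<open>D (v\<^sup>k\<^sup>+\<^sup>1)\<close> (\<open>energy_decrease\<close>).

  Hence the iterates are bounded, and the increments and \<open>D (v\<^sup>k)\<close> tend to \<open>0\<close>. As the step sizes
  stay away from \<open>0\<close>, lower semicontinuity allows passage to the limit in the prox inequalities,
  so every cluster point is a saddle point (\<open>cluster_point_is_saddle\<close>). Relative to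
  such a cluster point the energy tends to \<open>0\<close> along a subsequence, hence, being monotone, along
  the whole sequence. This is convergence of the iterates, and \<open>P (u\<^sup>k) \<rightarrow> 0\<close> then follows from
  the prox inequality at \<open>uh\<close> (\<open>P_le\<close>).
\<close>

section \<open>Lower semicontinuous convex functions and the proximal map\<close>

text \<open>The form with convergent majorants \<open>b\<close> is made for iterates whose values are bounded by the
right-hand sides of prox inequalities.\<close>

lemma lsc_le_limit:
  fixes f :: "'a::t1_space \<Rightarrow> ereal"
  assumes "lsc f" "X \<longlonglongrightarrow> x" "b \<longlonglongrightarrow> B" "\<And>n. f (X n) \<le> b n"
  shows "f x \<le> B"
proof (rule ccontr)
  assume "\<not> f x \<le> B"
  then obtain y where y: "B < y" "y < f x"
    using dense[of B "f x"] by (auto simp: not_le)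
  have "f x \<le> Liminf (at x) f"
    using assms(1) by (simp add: lsc_def)
  then have "eventually (\<lambda>z. y < f z) (at x)"
    using y(2) by (simp add: le_Liminf_iff)
  then have "eventually (\<lambda>z. y < f z) (nhds x)"
    using y(2) by (auto simp: eventually_at_filter elim!: eventually_mono)
  then have "eventually (\<lambda>n. y < f (X n)) sequentially"
    using assms(2) unfolding filterlim_iff by blast
  moreover have "eventually (\<lambda>n. b n < y) sequentially"
    using assms(3) y(1) by (rule order_tendstoD)
  ultimately have "eventually (\<lambda>n. False) sequentially"
    by eventually_elim (meson assms(4) leD order_less_le_trans order_less_trans)
  then show False by simp
qed

text \<open>A minimising sequence has a convergent subsequence, and the limit is a minimiser by
lower semicontinuity. The continuous summand is moved to the other side of the inequality, where
it converges.\<close>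

lemma lsc_plus_continuous_attains_min:
  fixes f :: "'a::metric_space \<Rightarrow> ereal" and q :: "'a \<Rightarrow> real"
  assumes f: "lsc f" and q: "continuous_on UNIV q" and S: "compact S" "S \<noteq> {}"
  obtains x where "x \<in> S" "\<And>y. y \<in> S \<Longrightarrow> f x + ereal (q x) \<le> f y + ereal (q y)"
proof -
  define \<Phi> where "\<Phi> = (\<lambda>x. f x + ereal (q x))"
  obtain w where w: "\<And>n. w n \<in> \<Phi> ` S" "w \<longlonglongrightarrow> Inf (\<Phi> ` S)"
    using Inf_as_limit[of "\<Phi> ` S"] S(2) by auto
  have "\<exists>x. x \<in> S \<and> \<Phi> x = w n" for n using w(1)[of n] by auto
  then obtain X where X: "\<And>n. X n \<in> S" "\<And>n. \<Phi> (X n) = w n" by metis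
  obtain x r where xr: "x \<in> S" "strict_mono (r :: nat \<Rightarrow> nat)" "(X \<circ> r) \<longlonglongrightarrow> x"
    using S(1) X(1) unfolding compact_def by blast
  have w': "(w \<circ> r) \<longlonglongrightarrow> Inf (\<Phi> ` S)"
    using w(2) xr(2) by (rule LIMSEQ_subseq_LIMSEQ)
  have q': "(\<lambda>n. ereal (- q ((X \<circ> r) n))) \<longlonglongrightarrow> ereal (- q x)"
    using continuous_on_tendsto_compose[OF q xr(3)] by (auto intro!: tendsto_intros)
  have "(\<lambda>n. (w \<circ> r) n + ereal (- q ((X \<circ> r) n))) \<longlonglongrightarrow> Inf (\<Phi> ` S) + ereal (- q x)"
    by (rule tendsto_add_ereal_general1[OF _ w' q']) auto
  moreover have "f ((X \<circ> r) n) \<le> (w \<circ> r) n + ereal (- q ((X \<circ> r) n))" for n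
  proof -
    have "w (r n) = f (X (r n)) + ereal (q (X (r n)))"
      using X(2)[of "r n"] by (simp add: \<Phi>_def)
    then show ?thesis by (cases "f (X (r n))") auto
  qed
  ultimately have "f x \<le> Inf (\<Phi> ` S) + ereal (- q x)"
    by (rule lsc_le_limit[OF f xr(3)])
  then have "\<Phi> x \<le> Inf (\<Phi> ` S)"
    unfolding \<Phi>_def by (cases "f x"; cases "Inf ((\<lambda>x. f x + ereal (q x)) ` S)") auto
  then have "\<Phi> x \<le> \<Phi> y" if "y \<in> S" for y
    using that by (meson INF_lower order_trans)
  then show ?thesis
    using that[of x] xr(1) by (simp add: \<Phi>_def)
qed

lemma proper_finite:
  assumes "proper f" "f x \<noteq> \<infinity>"
  shows "f x = ereal (real_of_ereal (f x))"
  using assms by (cases "f x") (auto simp: proper_def)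

lemma ereal_convex_real:
  assumes "proper f" "ereal_convex f" "f x \<noteq> \<infinity>" "f y \<noteq> \<infinity>" "0 \<le> s" "s \<le> 1"
  shows "f ((1 - s) *\<^sub>R x + s *\<^sub>R y) \<le> ereal ((1 - s) * real_of_ereal (f x) + s * real_of_ereal (f y))"
proof -
  have "f ((1 - s) *\<^sub>R x + s *\<^sub>R y) \<le> ereal (1 - s) * f x + ereal s * f y"
    using assms(2,5,6) unfolding ereal_convex_def by simp
  then show ?thesis
    using proper_finite[OF assms(1,3)] proper_finite[OF assms(1,4)]
    by (metis plus_ereal.simps(1) times_ereal.simps(1))
qed

text \<open>The proximal map is a Hilbert choice of a minimiser, so the existence of one has to be shown:
outside of a large ball the objective exceeds its value at a fixed point of the domain, and inside
of it the minimum is attained by compactness.\<close>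

lemma prox_minimizes:
  fixes \<phi> :: "'a::euclidean_space \<Rightarrow> ereal"
  assumes "proper \<phi>" "lsc \<phi>" "ereal_convex \<phi>" "0 < \<tau>"
  shows "\<phi> (prox \<tau> \<phi> x) + ereal (1 / (2 * \<tau>) * (norm (prox \<tau> \<phi> x - x))\<^sup>2)
          \<le> \<phi> y + ereal (1 / (2 * \<tau>) * (norm (y - x))\<^sup>2)"
proof -
  let ?q = "\<lambda>y. 1 / (2 * \<tau>) * (norm (y - x))\<^sup>2"
  obtain x0 where x0: "\<phi> x0 \<noteq> \<infinity>" using assms(1) by (auto simp: proper_def)
  obtain xm where xm: "xm \<in> cball x0 1" "\<And>y. y \<in> cball x0 1 \<Longrightarrow> \<phi> xm \<le> \<phi> y"
    using lsc_plus_continuous_attains_min[OF assms(2), of "\<lambda>_. 0" "cball x0 1"] by auto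
  define A where "A = real_of_ereal (\<phi> x0)"
  define m where "m = real_of_ereal (\<phi> xm)"
  have A: "\<phi> x0 = ereal A" using proper_finite[OF assms(1) x0] by (simp add: A_def)
  have m_le: "\<phi> xm \<le> ereal A" using xm(2)[of x0] A by simp
  then have m: "\<phi> xm = ereal m" using proper_finite[OF assms(1), of xm] by (force simp: m_def)
  define C where "C = A - m"
  have C: "C \<ge> 0" using m_le m by (simp add: C_def)
  define e where "e = norm (x0 - x)"
  define R where "R = 2 * e + 2 * \<tau> * C + 1"
  have R: "R \<ge> 1" using C assms(4) by (simp add: R_def e_def)
  obtain p where p: "p \<in> cball x0 R" "\<And>y. y \<in> cball x0 R \<Longrightarrow> \<phi> p + ereal (?q p) \<le> \<phi> y + ereal (?q y)"
    by (rule lsc_plus_continuous_attains_min[OF assms(2), of ?q "cball x0 R"])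
       (use R assms(4) in \<open>auto intro!: continuous_intros\<close>)
  \<comment> \<open>Convexity along the segment from the centre to a distant point shows that \<open>\<phi>\<close> decreases at most
     linearly, so that the quadratic term dominates outside of the ball of radius \<open>R\<close>.\<close>
  have far: "\<phi> x0 + ereal (?q x0) \<le> \<phi> y + ereal (?q y)" if y: "y \<notin> cball x0 R" for y
  proof (cases "\<phi> y = \<infinity>")
    case False
    define B where "B = real_of_ereal (\<phi> y)"
    have B: "\<phi> y = ereal B" using proper_finite[OF assms(1) False] by (simp add: B_def)
    define r where "r = norm (y - x0)"
    have r: "r > R" using y by (simp add: r_def dist_norm norm_minus_commute)
    then have r1: "r \<ge> 1" "r > 0" using R by auto
    have "(1 - 1/r) *\<^sub>R x0 + (1/r) *\<^sub>R y = x0 + (1/r) *\<^sub>R (y - x0)"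
      by (simp add: algebra_simps)
    moreover have "x0 + (1/r) *\<^sub>R (y - x0) \<in> cball x0 1"
      using r1 by (simp add: dist_norm r_def)
    ultimately have "\<phi> xm \<le> \<phi> ((1 - 1/r) *\<^sub>R x0 + (1/r) *\<^sub>R y)"
      using xm(2) by simp
    also have "\<dots> \<le> ereal ((1 - 1/r) * A + (1/r) * B)"
      using ereal_convex_real[OF assms(1,3) x0 False, of "1/r"] r1 by (simp add: A_def B_def)
    finally have "m \<le> (1 - 1/r) * A + (1/r) * B" using m by simp
    then have "r * m \<le> r * ((1 - 1/r) * A + (1/r) * B)"
      using r1 by (intro mult_left_mono) auto
    also have "\<dots> = (r - 1) * A + B" using r1 by (simp add: field_simps)
    finally have AB: "A - r * C \<le> B" by (simp add: C_def algebra_simps)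
    have "r \<le> norm (y - x) + e"
      unfolding r_def e_def using norm_triangle_ineq4[of "y - x" "x0 - x"] by simp
    then have "r - e \<le> norm (y - x)" by simp
    moreover have "r - e \<ge> 0" using r C assms(4) by (simp add: R_def e_def add_nonneg_nonneg)
        (smt (verit) mult_nonneg_nonneg norm_ge_zero)
    ultimately have sq: "(r - e)\<^sup>2 \<le> (norm (y - x))\<^sup>2" by (intro power_mono) auto
    (* The radius R was chosen for this estimate: the quadratic term beats the linear loss r * C. *)
    have "r * (2 * \<tau> * C) \<le> r * (r - 2 * e)"
      using r r1 by (intro mult_left_mono) (auto simp: R_def)
    then have "2 * \<tau> * (r * C) + e\<^sup>2 \<le> (norm (y - x))\<^sup>2"
      using sq by (simp add: power2_eq_square algebra_simps)
    then have "(2 * \<tau> * (r * C) + e\<^sup>2) / (2 * \<tau>) \<le> (norm (y - x))\<^sup>2 / (2 * \<tau>)"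
      using assms(4) by (intro divide_right_mono) auto
    then have "r * C + e\<^sup>2 / (2 * \<tau>) \<le> (norm (y - x))\<^sup>2 / (2 * \<tau>)"
      using assms(4) by (simp add: add_divide_distrib)
    then show ?thesis using AB by (simp add: A B e_def)
  qed simp
  have glob: "\<phi> p + ereal (?q p) \<le> \<phi> y + ereal (?q y)" for y
  proof (cases "y \<in> cball x0 R")
    case False
    have "\<phi> p + ereal (?q p) \<le> \<phi> x0 + ereal (?q x0)" using p(2)[of x0] R by simp
    then show ?thesis using far[OF False] by (rule order_trans)
  qed (rule p(2))
  have "is_arg_min (\<lambda>y. \<phi> y + ereal (?q y)) (\<lambda>_. True) (prox \<tau> \<phi> x)"
    unfolding prox_def arg_min_def
    by (rule someI[where x = p]) (use glob in \<open>auto simp: is_arg_min_def not_less\<close>)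
  then show ?thesis by (auto simp: is_arg_min_def not_less)
qed

lemma prox_finite:
  fixes \<phi> :: "'a::euclidean_space \<Rightarrow> ereal"
  assumes "proper \<phi>" "lsc \<phi>" "ereal_convex \<phi>" "0 < \<tau>"
  shows "\<phi> (prox \<tau> \<phi> x) \<noteq> \<infinity>"
proof -
  obtain y where "\<phi> y \<noteq> \<infinity>" using assms(1) by (auto simp: proper_def)
  then show ?thesis using prox_minimizes[OF assms, of x y] by auto
qed

text \<open>Comparing the objective at the minimiser \<open>p\<close> with its value at \<open>(1 - s) p + s y\<close>, convexity
gives the claim up to an error of order \<open>s\<close>, which vanishes as \<open>s\<close> tends to \<open>0\<close>.\<close>

lemma prox_variational_inequality:
  fixes \<phi> :: "'a::euclidean_space \<Rightarrow> ereal" and x y :: 'a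
  assumes "proper \<phi>" "lsc \<phi>" "ereal_convex \<phi>" "0 < \<tau>" and y: "\<phi> y \<noteq> \<infinity>"
  defines "p \<equiv> prox \<tau> \<phi> x"
  shows "(x - p) \<bullet> (y - p) \<le> \<tau> * (real_of_ereal (\<phi> y) - real_of_ereal (\<phi> p))"
proof -
  define P where "P = real_of_ereal (\<phi> p)"
  define Y where "Y = real_of_ereal (\<phi> y)"
  have p: "\<phi> p \<noteq> \<infinity>" unfolding p_def by (rule prox_finite[OF assms(1-4)])
  then have P: "\<phi> p = ereal P" using proper_finite[OF assms(1)] by (simp add: P_def)
  have *: "(x - p) \<bullet> (y - p) - \<tau> * (Y - P) \<le> s * ((norm (y - p))\<^sup>2 / 2)" if s: "0 < s" "s \<le> 1" for s
  proof -
    define z where "z = (1 - s) *\<^sub>R p + s *\<^sub>R y"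
    have "\<phi> p + ereal (1 / (2 * \<tau>) * (norm (p - x))\<^sup>2) \<le> \<phi> z + ereal (1 / (2 * \<tau>) * (norm (z - x))\<^sup>2)"
      unfolding p_def by (rule prox_minimizes[OF assms(1-4)])
    also have "\<dots> \<le> ereal ((1 - s) * P + s * Y) + ereal (1 / (2 * \<tau>) * (norm (z - x))\<^sup>2)"
      using ereal_convex_real[OF assms(1,3) p y, of s] s
      by (intro add_right_mono) (simp add: z_def P_def Y_def)
    finally have "P + 1 / (2 * \<tau>) * (norm (p - x))\<^sup>2 \<le> (1 - s) * P + s * Y + 1 / (2 * \<tau>) * (norm (z - x))\<^sup>2"
      by (simp add: P)
    then have "2 * \<tau> * (s * (P - Y) + 1 / (2 * \<tau>) * (norm (p - x))\<^sup>2) \<le> 2 * \<tau> * (1 / (2 * \<tau>) * (norm (z - x))\<^sup>2)"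
      using assms(4) by (intro mult_left_mono) (auto simp: algebra_simps)
    then have "2 * \<tau> * (s * (P - Y)) + (norm (p - x))\<^sup>2 \<le> (norm (z - x))\<^sup>2"
      using assms(4) by (simp add: distrib_left)
    moreover have zx: "z - x = (p - x) + s *\<^sub>R (y - p)" by (simp add: z_def algebra_simps)
    have "(norm (z - x))\<^sup>2 = (norm (p - x))\<^sup>2 - 2 * s * ((x - p) \<bullet> (y - p)) + s * s * (norm (y - p))\<^sup>2"
      unfolding zx
      by (simp add: power2_norm_eq_inner inner_add_left inner_add_right inner_diff_left
          inner_diff_right inner_commute algebra_simps)
    ultimately have "s * (2 * ((x - p) \<bullet> (y - p) - \<tau> * (Y - P))) \<le> s * (s * (norm (y - p))\<^sup>2)"
      by (simp add: algebra_simps)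
    then show ?thesis using s by simp
  qed
  have "(x - p) \<bullet> (y - p) - \<tau> * (Y - P) \<le> 0"
  proof (rule LIMSEQ_le_const)
    show "(\<lambda>n. inverse (real (Suc n)) * ((norm (y - p))\<^sup>2 / 2)) \<longlonglongrightarrow> 0"
      using tendsto_mult_left_zero[OF LIMSEQ_inverse_real_of_nat] .
    show "\<exists>N. \<forall>n\<ge>N. (x - p) \<bullet> (y - p) - \<tau> * (Y - P) \<le> inverse (real (Suc n)) * ((norm (y - p))\<^sup>2 / 2)"
      by (intro exI allI impI *) (auto simp: field_simps)
  qed
  then show ?thesis by (simp add: P_def Y_def)
qed

section \<open>The smooth convex term\<close>

lemma GDERIV_gradient:
  fixes H :: "'a::euclidean_space \<Rightarrow> real"
  assumes "H differentiable_on UNIV"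
  shows "GDERIV H x :> gradient H x"
proof -
  obtain H' where H': "(H has_derivative H') (at x)"
    using assms by (auto simp: differentiable_on_def differentiable_def)
  then have "linear H'" by (rule has_derivative_linear)
  then have "H' = (\<lambda>h. h \<bullet> adjoint H' 1)" by (simp add: adjoint_works)
  with H' have D: "GDERIV H x :> adjoint H' 1" by (simp add: gderiv_def)
  have "D = adjoint H' 1" if "GDERIV H x :> D" for D
  proof -
    have "(\<lambda>h. h \<bullet> D) = (\<lambda>h. h \<bullet> adjoint H' 1)"
      using that D unfolding gderiv_def by (rule has_derivative_unique)
    then show ?thesis by (metis inner_commute vector_eq_rdot)
  qed
  with D have "gradient H x = adjoint H' 1" unfolding gradient_def by blast
  with D show ?thesis by simp
qed

text \<open>Along the segment from \<open>x\<close> to \<open>y\<close> this is the tangent inequality for convex functions of one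
real variable.\<close>

lemma convex_above_gradient:
  fixes H :: "'a::euclidean_space \<Rightarrow> real"
  assumes "H differentiable_on UNIV" "convex_on UNIV H"
  shows "H x + gradient H x \<bullet> (y - x) \<le> H y"
proof -
  define l where "l = (\<lambda>s::real. x + s *\<^sub>R (y - x))"
  have "(l has_derivative (\<lambda>s. s *\<^sub>R (y - x))) (at 0)"
    unfolding l_def by (auto intro!: derivative_eq_intros)
  moreover have "(H has_derivative (\<lambda>h. h \<bullet> gradient H x)) (at (l 0))"
    using GDERIV_gradient[OF assms(1), of x] by (simp add: l_def gderiv_def)
  ultimately have "(H \<circ> l has_derivative (\<lambda>h. h \<bullet> gradient H x) \<circ> (\<lambda>s. s *\<^sub>R (y - x))) (at 0)"
    by (rule diff_chain_at)
  then have D: "(H \<circ> l has_real_derivative gradient H x \<bullet> (y - x)) (at 0)"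
    by (simp add: has_field_derivative_def o_def inner_commute mult_commute_abs)
  have l: "l ((1 - t) * a + t * b) = (1 - t) *\<^sub>R l a + t *\<^sub>R l b" for a b t
    by (simp add: l_def algebra_simps)
  have "convex_on UNIV (H \<circ> l)"
  proof (rule convex_onI)
    fix t a b :: real assume "0 < t" "t < 1"
    then show "(H \<circ> l) ((1 - t) *\<^sub>R a + t *\<^sub>R b) \<le> (1 - t) * (H \<circ> l) a + t * (H \<circ> l) b"
      using convex_onD[OF assms(2), of t "l a" "l b"] l[of t a b] by simp
  qed simp
  then have "(H \<circ> l) 1 - (H \<circ> l) 0 \<ge> gradient H x \<bullet> (y - x) * (1 - 0)"
    by (rule convex_on_imp_above_tangent) (use D in auto)
  then show ?thesis by (simp add: l_def)
qed

lemma locally_lipschitz_continuous: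
  assumes "locally_lipschitz f"
  shows "continuous_on UNIV f"
  unfolding continuous_on_eq_continuous_at[OF open_UNIV]
proof
  fix x
  obtain r L where "r > 0" "L-lipschitz_on (ball x r) f"
    using assms unfolding locally_lipschitz_def by blast
  then show "isCont f x"
    using lipschitz_on_continuous_on[of L "ball x r" f] continuous_on_interior[of "ball x r" f x] by simp
qed

section \<open>Saddle points\<close>

text \<open>Comparing \<open>(uh, vh)\<close> with points of the two domains forces \<open>\<Psi> (uh, vh)\<close> to be finite, hence
\<open>uh\<close> and \<open>vh\<close> to lie in the domains; from then on only real numbers are compared.\<close>

lemma saddle_point_iff:
  fixes K :: "'u::euclidean_space \<Rightarrow> 'v::euclidean_space"
  assumes K: "linear K" and G: "proper G" and F: "proper F"
  shows "saddle_point K G F H uh vh \<longleftrightarrow> G uh \<noteq> \<infinity> \<and> F vh \<noteq> \<infinity> \<and>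
      (\<forall>x. G x \<noteq> \<infinity> \<longrightarrow> 0 \<le> real_of_ereal (G x) - real_of_ereal (G uh) + K (x - uh) \<bullet> vh) \<and>
      (\<forall>y. F y \<noteq> \<infinity> \<longrightarrow> 0 \<le> (real_of_ereal (F y) + H y) - (real_of_ereal (F vh) + H vh) - K uh \<bullet> (y - vh))"
    (is "?L \<longleftrightarrow> ?R")
proof
  assume L: ?L
  have 1: "Psi K G F H uh y \<le> Psi K G F H uh vh" and 2: "Psi K G F H uh vh \<le> Psi K G F H x vh" for x y
    using L by (auto simp: saddle_point_def)
  obtain u0 v0 where uv0: "G u0 \<noteq> \<infinity>" "F v0 \<noteq> \<infinity>" using G F by (auto simp: proper_def)
  have Gn: "G x \<noteq> -\<infinity>" and Fn: "F y \<noteq> -\<infinity>" for x y using G F by (auto simp: proper_def)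
  have "Psi K G F H u0 vh \<noteq> \<infinity>"
    using proper_finite[OF G uv0(1)] Fn[of vh] unfolding Psi_def by (cases "G u0"; cases "F vh") auto
  then have fin: "Psi K G F H uh vh \<noteq> \<infinity>" using 2[of u0] by auto
  have "Psi K G F H uh v0 \<noteq> -\<infinity>"
    using proper_finite[OF F uv0(2)] Gn[of uh] unfolding Psi_def by (cases "G uh"; cases "F v0") auto
  then have "Psi K G F H uh vh \<noteq> -\<infinity>" using 1[of v0] by auto
  with fin have dom: "G uh \<noteq> \<infinity>" "F vh \<noteq> \<infinity>"
    unfolding Psi_def using Gn[of uh] Fn[of vh] by (cases "G uh"; cases "F vh"; auto)+
  obtain g f where gf: "G uh = ereal g" "F vh = ereal f"
    using proper_finite[OF G dom(1)] proper_finite[OF F dom(2)] by metis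
  have "0 \<le> real_of_ereal (G x) - real_of_ereal (G uh) + K (x - uh) \<bullet> vh" if "G x \<noteq> \<infinity>" for x
    using 2[of x] proper_finite[OF G that] gf
    by (cases "G x") (auto simp: Psi_def linear_diff[OF K] inner_diff_left)
  moreover have "0 \<le> (real_of_ereal (F y) + H y) - (real_of_ereal (F vh) + H vh) - K uh \<bullet> (y - vh)"
    if "F y \<noteq> \<infinity>" for y
    using 1[of y] proper_finite[OF F that] gf
    by (cases "F y") (auto simp: Psi_def inner_diff_right)
  ultimately show ?R using dom by blast
next
  assume R: ?R
  obtain g f where gf: "G uh = ereal g" "F vh = ereal f"
    using R proper_finite[OF G, of uh] proper_finite[OF F, of vh] by metis
  show ?L
    unfolding saddle_point_def
  proof (intro allI conjI)
    fix x y
    show "Psi K G F H uh y \<le> Psi K G F H uh vh"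
    proof (cases "F y = \<infinity>")
      case False
      then obtain a where "F y = ereal a" using proper_finite[OF F False] by metis
      then show ?thesis using R gf by (auto simp: Psi_def inner_diff_right dest!: spec[of _ y])
    qed (simp add: Psi_def gf)
    show "Psi K G F H uh vh \<le> Psi K G F H x vh"
    proof (cases "G x = \<infinity>")
      case False
      then obtain a where "G x = ereal a" using proper_finite[OF G False] by metis
      then show ?thesis using R gf 
        by (auto simp: Psi_def linear_diff[OF K] inner_diff_left dest!: spec[of _ x])
    qed (simp add: Psi_def gf)
  qed
qed

section \<open>The one-step inequality\<close>

text \<open>One step of the iteration, with \<open>u0, u1, u2\<close> three consecutive primal iterates, \<open>v1, v2\<close> two
consecutive dual iterates, \<open>s\<close> and \<open>t\<close> the step sizes before and after the linesearch and
\<open>h\<close> the gradient of the smooth term at \<open>v1\<close>; function values are represented by real numbers.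
The inequality is the sum of \<open>a\<close>, \<open>\<theta>\<close> times \<open>b\<close>, \<open>\<theta>\<^sup>2\<close> times \<open>c\<close>, \<open>d\<close> divided by \<open>\<beta>\<close>, \<open>t\<close> times
\<open>e1\<close>, and \<open>e2\<close>.\<close>

lemma pd_step_inequality:
  fixes K :: "'u::euclidean_space \<Rightarrow> 'v::euclidean_space"
  assumes K: "linear K" and \<beta>: "\<beta> > 0" and \<theta>: "\<theta> \<ge> 0" "t = \<theta> * s"
    and ub: "ub = u1 + \<theta> *\<^sub>R (u1 - u0)"
    and a: "(u1 - t *\<^sub>R adjoint K v2 - u2) \<bullet> (uh - u2) \<le> t * (Gh - G2)"
    and b: "(u0 - s *\<^sub>R adjoint K v1 - u1) \<bullet> (u2 - u1) \<le> s * (G2 - G1)"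
    and c: "(u0 - s *\<^sub>R adjoint K v1 - u1) \<bullet> (u0 - u1) \<le> s * (G0 - G1)"
    and d: "(v1 + (\<beta> * t) *\<^sub>R (K ub - h) - v2) \<bullet> (vh - v2) \<le> \<beta> * t * (Fh - F2)"
    and t: "0 \<le> t" and e1: "H1 + h \<bullet> (vh - v1) \<le> Hh"
    and e2: "t * (H2 - H1 - h \<bullet> (v2 - v1)) \<le> \<delta> / (2 * \<beta>) * (norm (v2 - v1))\<^sup>2"
  shows "(norm (uh - u2))\<^sup>2 / 2 + (norm (vh - v2))\<^sup>2 / (2 * \<beta>)
           + t * (1 + \<theta>) * (G1 - Gh + K (u1 - uh) \<bullet> vh)
           + t * ((F2 + H2) - (Fh + Hh) - K uh \<bullet> (v2 - vh))
         \<le> (norm (uh - u1))\<^sup>2 / 2 + (norm (vh - v1))\<^sup>2 / (2 * \<beta>)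
           + t * \<theta> * (G0 - Gh + K (u0 - uh) \<bullet> vh)
           - (norm (ub - u1))\<^sup>2 / 2 - (norm (u2 - ub))\<^sup>2 / 2
           - (1 - \<delta>) / (2 * \<beta>) * (norm (v2 - v1))\<^sup>2
           - t * (K (u2 - ub) \<bullet> (v2 - v1))"
proof -
  have adj: "adjoint K y \<bullet> x = K x \<bullet> y" for x y
    using adjoint_works[OF K, of x y] by (simp add: inner_commute)
  have a': "(u1 - u2) \<bullet> (uh - u2) - t * (K (uh - u2) \<bullet> v2) \<le> t * (Gh - G2)"
    using a by (simp add: inner_diff_left adj linear_diff[OF K] algebra_simps)
  have "\<theta> * ((u0 - s *\<^sub>R adjoint K v1 - u1) \<bullet> (u2 - u1)) \<le> \<theta> * (s * (G2 - G1))"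
    using b \<theta> by (intro mult_left_mono) auto
  then have b': "\<theta> * ((u0 - u1) \<bullet> (u2 - u1)) - t * (K (u2 - u1) \<bullet> v1) \<le> t * (G2 - G1)"
    using \<theta>(2) by (simp add: inner_diff_left adj linear_diff[OF K] algebra_simps)
  have "\<theta> * \<theta> * ((u0 - s *\<^sub>R adjoint K v1 - u1) \<bullet> (u0 - u1)) \<le> \<theta> * \<theta> * (s * (G0 - G1))"
    using c \<theta> by (intro mult_left_mono) auto
  then have c': "\<theta> * \<theta> * ((u0 - u1) \<bullet> (u0 - u1)) - \<theta> * t * (K (u0 - u1) \<bullet> v1) \<le> \<theta> * t * (G0 - G1)"
    using \<theta>(2) by (simp add: inner_diff_left adj linear_diff[OF K] algebra_simps)
  have "((v1 - v2) \<bullet> (vh - v2)) / \<beta> + t * ((K ub - h) \<bullet> (vh - v2))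
      = ((v1 + (\<beta> * t) *\<^sub>R (K ub - h) - v2) \<bullet> (vh - v2)) / \<beta>"
    using \<beta> by (simp add: inner_diff_left inner_add_left field_simps)
  also have "\<dots> \<le> (\<beta> * t * (Fh - F2)) / \<beta>"
    using d \<beta> by (intro divide_right_mono) auto
  finally have d': "((v1 - v2) \<bullet> (vh - v2)) / \<beta> + t * ((K ub - h) \<bullet> (vh - v2)) \<le> t * (Fh - F2)"
    using \<beta> by simp
  have "t * (H1 + h \<bullet> (vh - v1)) \<le> t * Hh"
    using e1 t by (rule mult_left_mono)
  then have e': "t * (h \<bullet> (vh - v2)) - \<delta> / (2 * \<beta>) * (norm (v2 - v1))\<^sup>2 \<le> t * (Hh - H2)"
    using e2 by (simp add: algebra_simps)
  (* Polarisation turns the inner products into squared distances; the terms |u2 - u1|^2 of ca and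
     cb cancel. *)
  have ca: "(u1 - u2) \<bullet> (uh - u2) = (norm (u2 - u1))\<^sup>2 / 2 + (norm (uh - u2))\<^sup>2 / 2 - (norm (uh - u1))\<^sup>2 / 2"
    by (simp add: power2_norm_eq_inner inner_diff_left inner_diff_right inner_commute field_simps)
  have cb: "\<theta> * ((u0 - u1) \<bullet> (u2 - u1)) + \<theta> * \<theta> * ((u0 - u1) \<bullet> (u0 - u1))
      = (norm (ub - u1))\<^sup>2 / 2 + (norm (u2 - ub))\<^sup>2 / 2 - (norm (u2 - u1))\<^sup>2 / 2"
    unfolding ub
    by (simp add: power2_norm_eq_inner inner_diff_left inner_diff_right inner_add_left
        inner_add_right inner_commute field_simps)
  have cd: "((v1 - v2) \<bullet> (vh - v2)) / \<beta>
      = (norm (vh - v2))\<^sup>2 / (2*\<beta>) - (norm (vh - v1))\<^sup>2 / (2*\<beta>) + (norm (v2 - v1))\<^sup>2 / (2*\<beta>)"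
    using \<beta> by (simp add: power2_norm_eq_inner inner_diff_left inner_diff_right inner_commute field_simps)
  have Kub: "K ub = K u1 + \<theta> *\<^sub>R (K u1 - K u0)"
    unfolding ub by (simp add: K linear_add linear_diff linear_scale)
  (* The terms in K combine to the linear parts of the gaps and to one term that is a product of
     increments. *)
  have coupling: "t * (K (uh - u2) \<bullet> v2) + t * (K (u2 - u1) \<bullet> v1) + \<theta> * t * (K (u0 - u1) \<bullet> v1)
      - t * (K ub \<bullet> (vh - v2)) 
      = - t * (1 + \<theta>) * (K (u1 - uh) \<bullet> vh) + t * \<theta> * (K (u0 - uh) \<bullet> vh)
        + t * (K uh \<bullet> (v2 - vh)) - t * (K (u2 - ub) \<bullet> (v2 - v1))"
    by (simp add: K linear_diff Kub inner_diff_left inner_diff_right inner_add_left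
        inner_add_right algebra_simps)
  have "(1 - \<delta>) / (2 * \<beta>) * (norm (v2 - v1))\<^sup>2
      = (norm (v2 - v1))\<^sup>2 / (2 * \<beta>) - \<delta> / (2 * \<beta>) * (norm (v2 - v1))\<^sup>2"
    by (simp add: diff_divide_distrib algebra_simps)
  moreover have "t * ((K ub - h) \<bullet> (vh - v2)) = t * (K ub \<bullet> (vh - v2)) - t * (h \<bullet> (vh - v2))"
    by (simp add: inner_diff_left algebra_simps)
  ultimately show ?thesis
    using a' b' c' d' e' ca cb cd coupling by (simp add: algebra_simps)
qed

text \<open>A quadratic form with negative discriminant is positive definite. The constant subtracted from
both diagonal coefficients is small enough for the discriminant to stay nonpositive.\<close>

lemma quadratic_form_coercive:
  fixes p q \<rho> :: real
  assumes "0 < p" "0 < q" "\<rho>\<^sup>2 < 4 * p * q"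
  obtains \<kappa> where "0 < \<kappa>" "\<And>a b. \<kappa> * (a\<^sup>2 + b\<^sup>2) \<le> p * a\<^sup>2 + q * b\<^sup>2 - \<rho> * (a * b)"
proof -
  define \<kappa> where "\<kappa> = (4 * p * q - \<rho>\<^sup>2) / (4 * (p + q))"
  define P where "P = p - \<kappa>"
  define Q where "Q = q - \<kappa>"
  have "\<kappa> * (4 * (p + q)) = 4 * p * q - \<rho>\<^sup>2"
    unfolding \<kappa>_def using assms by (intro nonzero_eq_divide_eq[THEN iffD1]) auto
  then have \<kappa>: "\<kappa> > 0" "4 * (\<kappa> * (p + q)) = 4 * p * q - \<rho>\<^sup>2"
    using assms by (auto simp: algebra_simps) (simp add: \<kappa>_def)
  have "\<kappa> * (p + q) \<le> p * q" using \<kappa>(2) zero_le_power2[of \<rho>] by linarith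
  also have "p * q < p * (p + q)" using assms by simp
  finally have P: "P > 0" using assms unfolding P_def by simp
  have "4 * P * Q = 4 * p * q - 4 * (\<kappa> * (p + q)) + 4 * \<kappa>\<^sup>2"
    by (simp add: P_def Q_def power2_eq_square algebra_simps)
  then have PQ: "4 * P * Q \<ge> \<rho>\<^sup>2" using \<kappa>(2) zero_le_power2[of \<kappa>] by linarith
  have "\<kappa> * (a\<^sup>2 + b\<^sup>2) \<le> p * a\<^sup>2 + q * b\<^sup>2 - \<rho> * (a * b)" for a b
  proof -
    have "4 * P * (P * a\<^sup>2 + Q * b\<^sup>2 - \<rho> * (a * b)) = (2 * P * a - \<rho> * b)\<^sup>2 + (4 * P * Q - \<rho>\<^sup>2) * b\<^sup>2"
      by (simp add: power2_eq_square algebra_simps)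
    also have "\<dots> \<ge> 0" using PQ by simp
    finally have "P * a\<^sup>2 + Q * b\<^sup>2 - \<rho> * (a * b) \<ge> 0"
      using P by (simp add: zero_le_mult_iff)
    then show ?thesis by (simp add: P_def Q_def algebra_simps)
  qed
  with \<kappa>(1) that show ?thesis by blast
qed

section \<open>Convergence of sequences satisfying the step inequalities\<close>

text \<open>What the convergence proof needs to know of a run: variational inequalities instead of proximal
maps, and step size bounds with a descent condition instead of the linesearch. The shifted indices reflect that
\<open>u 0\<close> and \<open>v 1\<close> are arbitrary, so that only \<open>u (Suc n)\<close> and \<open>v (Suc (Suc n))\<close> are known to lie
in the domains of \<open>G\<close> and \<open>F\<close>. The number \<open>\<rho>\<close> stands for \<open>sqrt (\<delta>K / \<beta>)\<close>.\<close>

locale pd_iteration =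
  fixes K :: "'u::euclidean_space \<Rightarrow> 'v::euclidean_space"
    and G :: "'u \<Rightarrow> ereal" and F :: "'v \<Rightarrow> ereal" and H :: "'v \<Rightarrow> real" and grad :: "'v \<Rightarrow> 'v"
    and \<beta> \<delta> \<rho> c T :: real and \<tau> \<theta> :: "nat \<Rightarrow> real" and u :: "nat \<Rightarrow> 'u" and v :: "nat \<Rightarrow> 'v"
  assumes K: "linear K"
    and G: "proper G" "lsc G" and F: "proper F" "lsc F"
    and grad_cont: "continuous_on UNIV grad"
    and H_above: "H z + grad z \<bullet> (y - z) \<le> H y"
    and \<beta>: "0 < \<beta>" and \<delta>: "\<delta> < 1" and \<rho>: "\<rho>\<^sup>2 < (1 - \<delta>) / \<beta>"
    and c: "0 < c" "c \<le> \<tau> n"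
    and \<tau>_onorm: "\<tau> (Suc n) * onorm K \<le> \<rho>" and \<tau>_le: "\<tau> (Suc n) \<le> T"
    and \<theta>0: "\<theta> 0 = 1" and \<theta>: "\<theta> (Suc n) = \<tau> (Suc n) / \<tau> n"
    and \<theta>_sq: "(\<theta> (Suc n))\<^sup>2 \<le> 1 + \<theta> n"
    and u_dom: "G (u (Suc n)) \<noteq> \<infinity>"
    and u_step: "G x \<noteq> \<infinity> \<Longrightarrow>
      (u n - \<tau> n *\<^sub>R adjoint K (v (Suc n)) - u (Suc n)) \<bullet> (x - u (Suc n))
        \<le> \<tau> n * (real_of_ereal (G x) - real_of_ereal (G (u (Suc n))))"
    and v_dom: "F (v (Suc (Suc n))) \<noteq> \<infinity>"
    and v_step: "F y \<noteq> \<infinity> \<Longrightarrow>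
      (v (Suc n) + (\<beta> * \<tau> (Suc n)) *\<^sub>R (K (u (Suc n) + \<theta> (Suc n) *\<^sub>R (u (Suc n) - u n)) - grad (v (Suc n)))
         - v (Suc (Suc n))) \<bullet> (y - v (Suc (Suc n)))
        \<le> \<beta> * \<tau> (Suc n) * (real_of_ereal (F y) - real_of_ereal (F (v (Suc (Suc n)))))"
    and v_ls: "\<tau> (Suc n) * (H (v (Suc (Suc n))) - H (v (Suc n)) - grad (v (Suc n)) \<bullet> (v (Suc (Suc n)) - v (Suc n)))
        \<le> \<delta> / (2 * \<beta>) * (norm (v (Suc (Suc n)) - v (Suc n)))\<^sup>2"
begin

abbreviation "g x \<equiv> real_of_ereal (G x)"
abbreviation "f y \<equiv> real_of_ereal (F y)"

text \<open>Real-valued versions of the primal and dual gaps; they agree with these on the domains.\<close>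

definition "P uh vh x = g x - g uh + K (x - uh) \<bullet> vh"
definition "D uh vh y = (f y + H y) - (f vh + H vh) - K uh \<bullet> (y - vh)"
definition "ubar n = u (Suc n) + \<theta> (Suc n) *\<^sub>R (u (Suc n) - u n)"
definition "energy uh vh n =
  (norm (uh - u (Suc n)))\<^sup>2 / 2 + (norm (vh - v (Suc n)))\<^sup>2 / (2 * \<beta>) + \<tau> n * (1 + \<theta> n) * P uh vh (u n)"

lemma \<tau>_pos: "\<tau> n > 0"
  using c(1) c(2)[of n] by linarith

lemma \<theta>_pos: "\<theta> n > 0"
  by (cases n) (simp_all add: \<theta>0 \<theta> \<tau>_pos)

lemma \<theta>_le_2: "\<theta> n \<le> 2"
proof (induction n)
  case (Suc n)
  have "(\<theta> (Suc n))\<^sup>2 \<le> 2\<^sup>2" using \<theta>_sq[of n] Suc by simp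
  then show ?case by (rule power2_le_imp_le) simp
qed (simp add: \<theta>0)

lemma saddle_gaps:
  assumes "saddle_point K G F H uh vh"
  shows "G uh \<noteq> \<infinity>" "F vh \<noteq> \<infinity>" "G x \<noteq> \<infinity> \<Longrightarrow> 0 \<le> P uh vh x" "F y \<noteq> \<infinity> \<Longrightarrow> 0 \<le> D uh vh y"
  using assms unfolding saddle_point_iff[OF K G(1) F(1)] P_def D_def by auto

lemma energy_ge_distances:
  assumes "saddle_point K G F H uh vh"
  shows "(norm (uh - u (Suc (Suc n))))\<^sup>2 / 2 + (norm (vh - v (Suc (Suc n))))\<^sup>2 / (2 * \<beta>) \<le> energy uh vh (Suc n)"
  using saddle_gaps(3)[OF assms u_dom[of n]] \<tau>_pos[of "Suc n"] \<theta>_pos[of "Suc n"]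
  by (simp add: energy_def)

definition "dissipation \<kappa> uh vh n =
  \<kappa> * ((norm (u (Suc (Suc (Suc n))) - ubar (Suc n)))\<^sup>2 + (norm (v (Suc (Suc (Suc n))) - v (Suc (Suc n))))\<^sup>2)
  + (norm (ubar (Suc n) - u (Suc (Suc n))))\<^sup>2 / 2
  + \<tau> (Suc (Suc n)) * D uh vh (v (Suc (Suc (Suc n))))"

text \<open>The energy is considered from index \<open>Suc n\<close> on, as the one-step inequality compares \<open>u\<^sup>k\<close> with
\<open>u\<^sup>k\<^sup>-\<^sup>1\<close> and so requires \<open>G (u\<^sup>k\<^sup>-\<^sup>1)\<close> to be finite. The constant \<open>\<kappa>\<close> comes from absorbing the coupling
term into the squared increments, and it does not depend on the saddle point.\<close>

lemma energy_decrease: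
  obtains \<kappa> where "0 < \<kappa>" "\<And>uh vh n. saddle_point K G F H uh vh \<Longrightarrow>
     energy uh vh (Suc (Suc n)) + dissipation \<kappa> uh vh n \<le> energy uh vh (Suc n)"
proof -
  have "\<rho>\<^sup>2 < 4 * (1/2) * ((1 - \<delta>) / (2 * \<beta>))" using \<rho> \<beta> by (simp add: field_simps)
  then obtain \<kappa> where \<kappa>: "0 < \<kappa>"
      "\<And>a b. \<kappa> * (a\<^sup>2 + b\<^sup>2) \<le> 1/2 * a\<^sup>2 + (1 - \<delta>) / (2 * \<beta>) * b\<^sup>2 - \<rho> * (a * b)"
    using quadratic_form_coercive[of "1/2" "(1 - \<delta>) / (2 * \<beta>)" \<rho>] \<delta> \<beta> by auto
  show ?thesis
  proof (rule that[OF \<kappa>(1)])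
    fix uh vh n assume sp: "saddle_point K G F H uh vh"
    let ?k = "Suc n"
    define u0 u1 u2 where "u0 = u ?k" and "u1 = u (Suc ?k)" and "u2 = u (Suc (Suc ?k))"
    define v1 v2 where "v1 = v (Suc ?k)" and "v2 = v (Suc (Suc ?k))"
    define t th where "t = \<tau> (Suc ?k)" and "th = \<theta> (Suc ?k)"
    have t: "t > 0" "t = th * \<tau> ?k"
      using \<tau>_pos[of ?k] \<tau>_pos[of "Suc ?k"] by (auto simp: t_def th_def \<theta>)
    have ub: "ubar ?k = u1 + th *\<^sub>R (u1 - u0)" by (simp add: ubar_def u1_def u0_def th_def)
    have "(norm (uh - u2))\<^sup>2 / 2 + (norm (vh - v2))\<^sup>2 / (2 * \<beta>)
           + t * (1 + th) * (g u1 - g uh + K (u1 - uh) \<bullet> vh)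
           + t * ((f v2 + H v2) - (f vh + H vh) - K uh \<bullet> (v2 - vh))
         \<le> (norm (uh - u1))\<^sup>2 / 2 + (norm (vh - v1))\<^sup>2 / (2 * \<beta>)
           + t * th * (g u0 - g uh + K (u0 - uh) \<bullet> vh)
           - (norm (ubar ?k - u1))\<^sup>2 / 2 - (norm (u2 - ubar ?k))\<^sup>2 / 2
           - (1 - \<delta>) / (2 * \<beta>) * (norm (v2 - v1))\<^sup>2
           - t * (K (u2 - ubar ?k) \<bullet> (v2 - v1))"
    proof (rule pd_step_inequality[OF K \<beta> _ t(2) ub, where h = "grad v1"])
      show "(u1 - t *\<^sub>R adjoint K v2 - u2) \<bullet> (uh - u2) \<le> t * (g uh - g u2)"
        unfolding u1_def u2_def v2_def t_def by (rule u_step[OF saddle_gaps(1)[OF sp]])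
      show "(u0 - \<tau> ?k *\<^sub>R adjoint K v1 - u1) \<bullet> (u2 - u1) \<le> \<tau> ?k * (g u2 - g u1)"
        unfolding u0_def u1_def u2_def v1_def by (rule u_step[OF u_dom])
      show "(u0 - \<tau> ?k *\<^sub>R adjoint K v1 - u1) \<bullet> (u0 - u1) \<le> \<tau> ?k * (g u0 - g u1)"
        unfolding u0_def u1_def v1_def by (rule u_step[OF u_dom])
      show "(v1 + (\<beta> * t) *\<^sub>R (K (ubar ?k) - grad v1) - v2) \<bullet> (vh - v2) \<le> \<beta> * t * (f vh - f v2)"
        unfolding v1_def v2_def t_def ubar_def by (rule v_step[OF saddle_gaps(2)[OF sp]])
      show "t * (H v2 - H v1 - grad v1 \<bullet> (v2 - v1)) \<le> \<delta> / (2 * \<beta>) * (norm (v2 - v1))\<^sup>2"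
        unfolding v1_def v2_def t_def by (rule v_ls)
    qed (use t H_above \<theta>_pos[of "Suc ?k"] in \<open>auto simp: th_def\<close>)
    moreover have "- t * (K (u2 - ubar ?k) \<bullet> (v2 - v1)) \<le> \<rho> * (norm (u2 - ubar ?k) * norm (v2 - v1))"
    proof -
      have "- (K (u2 - ubar ?k) \<bullet> (v2 - v1)) \<le> norm (K (u2 - ubar ?k)) * norm (v2 - v1)"
        using Cauchy_Schwarz_ineq2[of "K (u2 - ubar ?k)" "v2 - v1"] by linarith
      also have "\<dots> \<le> onorm K * norm (u2 - ubar ?k) * norm (v2 - v1)"
        using K by (intro mult_right_mono onorm) (auto simp: linear_linear)
      finally have "t * - (K (u2 - ubar ?k) \<bullet> (v2 - v1)) \<le> t * (onorm K * norm (u2 - ubar ?k) * norm (v2 - v1))"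
        using t(1) by (intro mult_left_mono) auto
      also have "\<dots> = (t * onorm K) * (norm (u2 - ubar ?k) * norm (v2 - v1))" by simp
      also have "\<dots> \<le> \<rho> * (norm (u2 - ubar ?k) * norm (v2 - v1))"
        unfolding t_def by (intro mult_right_mono \<tau>_onorm) auto
      finally show ?thesis by simp
    qed
    (* The growth restriction on the step sizes lets the gap terms of consecutive steps telescope. *)
    moreover have "t * th * P uh vh u0 \<le> \<tau> ?k * (1 + \<theta> ?k) * P uh vh u0"
    proof -
      have "\<tau> ?k * th\<^sup>2 \<le> \<tau> ?k * (1 + \<theta> ?k)"
        unfolding th_def using \<theta>_sq \<tau>_pos[of ?k] by (intro mult_left_mono) auto
      then have "t * th \<le> \<tau> ?k * (1 + \<theta> ?k)" using t(2) by (simp add: power2_eq_square mult_ac)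
      then show ?thesis
        unfolding u0_def by (intro mult_right_mono saddle_gaps(3)[OF sp] u_dom)
    qed
    moreover note \<kappa>(2)[of "norm (u2 - ubar ?k)" "norm (v2 - v1)"]
    ultimately show "energy uh vh (Suc ?k) + dissipation \<kappa> uh vh n \<le> energy uh vh ?k"
      unfolding energy_def dissipation_def u0_def[symmetric] u1_def[symmetric] u2_def[symmetric] v1_def[symmetric]
        v2_def[symmetric] t_def[symmetric] th_def[symmetric] P_def D_def by linarith
  qed
qed

lemma dissipation_nonneg:
  assumes "saddle_point K G F H uh vh" "0 < \<kappa>"
  shows "0 \<le> dissipation \<kappa> uh vh n"
  unfolding dissipation_def
  using saddle_gaps(4)[OF assms(1) v_dom] \<tau>_pos[of "Suc (Suc n)"] assms(2)
  by (intro add_nonneg_nonneg mult_nonneg_nonneg) auto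

lemma energy_decseq:
  assumes "saddle_point K G F H uh vh"
  shows "decseq (\<lambda>n. energy uh vh (Suc n))"
proof -
  obtain \<kappa> where \<kappa>: "0 < \<kappa>" "\<And>uh vh n. saddle_point K G F H uh vh \<Longrightarrow>
     energy uh vh (Suc (Suc n)) + dissipation \<kappa> uh vh n \<le> energy uh vh (Suc n)"
    using energy_decrease by blast
  show ?thesis
    unfolding decseq_Suc_iff
  proof
    show "energy uh vh (Suc (Suc n)) \<le> energy uh vh (Suc n)" for n
      using \<kappa>(2)[OF assms, of n] dissipation_nonneg[OF assms \<kappa>(1), of n] by linarith
  qed
qed

lemma energy_limit:
  assumes "saddle_point K G F H uh vh"
  obtains L where "(\<lambda>n. energy uh vh (Suc n)) \<longlonglongrightarrow> L"
proof -
  have "0 \<le> energy uh vh (Suc n)" for n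
    using energy_ge_distances[OF assms, of n] \<beta> by (smt (verit) divide_nonneg_nonneg zero_le_power2)
  then show ?thesis
    using decseq_convergent[OF energy_decseq[OF assms], of 0] that by blast
qed

text \<open>The energy converges, so its successive differences tend to \<open>0\<close>, and they dominate each summand
of the dissipation.\<close>

lemma remainders_tendsto_0:
  assumes sp: "saddle_point K G F H uh vh"
  shows "(\<lambda>n. u (Suc (Suc (Suc n))) - ubar (Suc n)) \<longlonglongrightarrow> 0"
    and "(\<lambda>n. v (Suc (Suc (Suc n))) - v (Suc (Suc n))) \<longlonglongrightarrow> 0"
    and "(\<lambda>n. ubar (Suc n) - u (Suc (Suc n))) \<longlonglongrightarrow> 0"
    and "(\<lambda>n. D uh vh (v (Suc (Suc (Suc n))))) \<longlonglongrightarrow> 0"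
proof -
  obtain \<kappa> where \<kappa>: "0 < \<kappa>" "\<And>uh vh n. saddle_point K G F H uh vh \<Longrightarrow>
     energy uh vh (Suc (Suc n)) + dissipation \<kappa> uh vh n \<le> energy uh vh (Suc n)"
    using energy_decrease by blast
  obtain L where L: "(\<lambda>n. energy uh vh (Suc n)) \<longlonglongrightarrow> L"
    using energy_limit[OF sp] .
  define e where "e = (\<lambda>n. energy uh vh (Suc n) - energy uh vh (Suc (Suc n)))"
  have "e \<longlonglongrightarrow> L - L"
    unfolding e_def by (intro tendsto_diff L LIMSEQ_Suc[OF L])
  then have e0: "e \<longlonglongrightarrow> 0" by simp
  have e: "\<kappa> * (norm (u (Suc (Suc (Suc n))) - ubar (Suc n)))\<^sup>2 \<le> e n"
      "\<kappa> * (norm (v (Suc (Suc (Suc n))) - v (Suc (Suc n))))\<^sup>2 \<le> e n"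
      "1/2 * (norm (ubar (Suc n) - u (Suc (Suc n))))\<^sup>2 \<le> e n"
      "c * D uh vh (v (Suc (Suc (Suc n)))) \<le> e n" for n
  proof -
    have D: "0 \<le> D uh vh (v (Suc (Suc (Suc n))))" by (rule saddle_gaps(4)[OF sp v_dom])
    have "0 \<le> \<kappa> * (norm (u (Suc (Suc (Suc n))) - ubar (Suc n)))\<^sup>2"
      "0 \<le> \<kappa> * (norm (v (Suc (Suc (Suc n))) - v (Suc (Suc n))))\<^sup>2" using \<kappa>(1) by auto
    moreover have "0 \<le> (norm (ubar (Suc n) - u (Suc (Suc n))))\<^sup>2" by simp
    moreover have "c * D uh vh (v (Suc (Suc (Suc n)))) \<le> \<tau> (Suc (Suc n)) * D uh vh (v (Suc (Suc (Suc n))))"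
      using D c by (intro mult_right_mono) auto
    moreover have "0 \<le> c * D uh vh (v (Suc (Suc (Suc n))))" using D c by simp
    moreover note \<kappa>(2)[OF sp, of n, unfolded dissipation_def]
    ultimately show "\<kappa> * (norm (u (Suc (Suc (Suc n))) - ubar (Suc n)))\<^sup>2 \<le> e n"
      "\<kappa> * (norm (v (Suc (Suc (Suc n))) - v (Suc (Suc n))))\<^sup>2 \<le> e n"
      "1/2 * (norm (ubar (Suc n) - u (Suc (Suc n))))\<^sup>2 \<le> e n"
      "c * D uh vh (v (Suc (Suc (Suc n)))) \<le> e n"
      unfolding e_def distrib_left by linarith+
  qed
  have squeeze: "b \<longlonglongrightarrow> 0" if "0 < a" "\<And>n. a * b n \<le> e n" "\<And>n. 0 \<le> b n" for a :: real and b
  proof (rule tendsto_sandwich[of "\<lambda>_. 0" b sequentially "\<lambda>n. e n / a"])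
    show "(\<lambda>n. e n / a) \<longlonglongrightarrow> 0" using tendsto_divide[OF e0 tendsto_const[of a]] that(1) by simp
  qed (use that in \<open>auto simp: field_simps\<close>)
  have norm_sq: "X \<longlonglongrightarrow> 0" if "0 < a" "\<And>n. a * (norm (X n))\<^sup>2 \<le> e n"
    for a :: real and X :: "nat \<Rightarrow> 'b::real_normed_vector"
  proof -
    have "(\<lambda>n. sqrt ((norm (X n))\<^sup>2)) \<longlonglongrightarrow> sqrt 0"
      by (intro tendsto_real_sqrt squeeze[of a]) (use that in auto)
    then show ?thesis by (simp add: tendsto_norm_zero_iff)
  qed
  show "(\<lambda>n. u (Suc (Suc (Suc n))) - ubar (Suc n)) \<longlonglongrightarrow> 0"
    by (rule norm_sq[OF \<kappa>(1) e(1)])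
  show "(\<lambda>n. v (Suc (Suc (Suc n))) - v (Suc (Suc n))) \<longlonglongrightarrow> 0"
    by (rule norm_sq[OF \<kappa>(1) e(2)])
  show "(\<lambda>n. ubar (Suc n) - u (Suc (Suc n))) \<longlonglongrightarrow> 0"
    by (rule norm_sq[OF _ e(3)]) simp
  show "(\<lambda>n. D uh vh (v (Suc (Suc (Suc n))))) \<longlonglongrightarrow> 0"
    by (rule squeeze[OF c(1) e(4)]) (rule saddle_gaps(4)[OF sp v_dom])
qed

text \<open>The prox inequality, solved for the value at the new iterate. Dividing by the step size is harmless
because it is at least \<open>c\<close>; the error term vanishes with the increments.\<close>

lemma g_iterate_le:
  assumes "G x \<noteq> \<infinity>"
  shows "g (u (Suc n)) \<le> g x + norm (u n - u (Suc n)) * norm (x - u (Suc n)) / c + K (x - u (Suc n)) \<bullet> v (Suc n)"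
proof -
  let ?q = "(u n - u (Suc n)) \<bullet> (x - u (Suc n))"
  have "adjoint K (v (Suc n)) \<bullet> (x - u (Suc n)) = K (x - u (Suc n)) \<bullet> v (Suc n)"
    using adjoint_works[OF K, of "x - u (Suc n)" "v (Suc n)"] by (simp add: inner_commute)
  then have "?q \<le> \<tau> n * (g x - g (u (Suc n)) + K (x - u (Suc n)) \<bullet> v (Suc n))"
    using u_step[OF assms, of n] by (simp add: inner_diff_left algebra_simps)
  then have "?q / \<tau> n \<le> g x - g (u (Suc n)) + K (x - u (Suc n)) \<bullet> v (Suc n)"
    using \<tau>_pos[of n] by (simp add: field_simps)
  moreover have "- ?q / \<tau> n \<le> norm (u n - u (Suc n)) * norm (x - u (Suc n)) / c"
    using Cauchy_Schwarz_ineq2[of "u n - u (Suc n)" "x - u (Suc n)"] c(1) c(2)[of n]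
    by (intro frac_le) auto
  ultimately show ?thesis by simp
qed

lemma f_iterate_le:
  assumes "F y \<noteq> \<infinity>"
  shows "f (v (Suc (Suc n))) \<le> f y + norm (v (Suc n) - v (Suc (Suc n))) * norm (y - v (Suc (Suc n))) / (\<beta> * c)
           - (K (ubar n) - grad (v (Suc n))) \<bullet> (y - v (Suc (Suc n)))"
proof -
  let ?q = "(v (Suc n) - v (Suc (Suc n))) \<bullet> (y - v (Suc (Suc n)))"
  let ?r = "(K (ubar n) - grad (v (Suc n))) \<bullet> (y - v (Suc (Suc n)))"
  have bt: "\<beta> * \<tau> (Suc n) > 0" using \<beta> \<tau>_pos by simp
  have "?q + (\<beta> * \<tau> (Suc n)) * ?r
      = (v (Suc n) + (\<beta> * \<tau> (Suc n)) *\<^sub>R (K (ubar n) - grad (v (Suc n))) - v (Suc (Suc n))) \<bullet> (y - v (Suc (Suc n)))"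
    by (simp only: inner_diff_left inner_add_left inner_scaleR_left)
  also have "\<dots> \<le> \<beta> * \<tau> (Suc n) * (f y - f (v (Suc (Suc n))))"
    unfolding ubar_def by (rule v_step[OF assms])
  finally have "?q \<le> (f y - f (v (Suc (Suc n))) - ?r) * (\<beta> * \<tau> (Suc n))"
    by (simp add: algebra_simps)
  then have "?q / (\<beta> * \<tau> (Suc n)) \<le> f y - f (v (Suc (Suc n))) - ?r"
    using bt by (simp add: pos_divide_le_eq)
  moreover have "- ?q / (\<beta> * \<tau> (Suc n)) \<le> norm (v (Suc n) - v (Suc (Suc n))) * norm (y - v (Suc (Suc n))) / (\<beta> * c)"
    using Cauchy_Schwarz_ineq2[of "v (Suc n) - v (Suc (Suc n))" "y - v (Suc (Suc n))"] c \<beta>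
    by (intro frac_le mult_left_mono) auto
  ultimately show ?thesis by simp
qed

lemma K_tendsto: "(X \<longlongrightarrow> x) M \<Longrightarrow> ((\<lambda>n. K (X n)) \<longlongrightarrow> K x) M"
  using K bounded_linear.tendsto linear_linear by blast

lemma increments_tendsto_0:
  assumes "saddle_point K G F H uh vh"
  shows "(\<lambda>n. u (Suc (Suc (Suc n))) - u (Suc (Suc n))) \<longlonglongrightarrow> 0"
  using tendsto_add[OF remainders_tendsto_0(1,3)[OF assms]] by simp

text \<open>Along the subsequence the neighbouring iterates and the extrapolated points have the same limits,
since the increments vanish. Thus the two iterate estimates pass to the limit by lower
semicontinuity; in the dual one the linearisation of \<open>H\<close> at the limit is then replaced by \<open>H\<close>,
using convexity.\<close>

lemma cluster_point_is_saddle: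
  assumes sp: "saddle_point K G F H uh vh" and r: "strict_mono (r :: nat \<Rightarrow> nat)"
    and lim: "(\<lambda>n. u (Suc (Suc (Suc (r n))))) \<longlonglongrightarrow> us" "(\<lambda>n. v (Suc (Suc (Suc (r n))))) \<longlonglongrightarrow> vs"
  shows "saddle_point K G F H us vs"
proof -
  note sub = LIMSEQ_subseq_LIMSEQ[OF _ r, unfolded o_def]
  note du = sub[OF increments_tendsto_0[OF sp]]
  note dv = sub[OF remainders_tendsto_0(2)[OF sp]]
  note db = sub[OF remainders_tendsto_0(1)[OF sp]]
  have u': "(\<lambda>n. u (Suc (Suc (r n)))) \<longlonglongrightarrow> us" using tendsto_diff[OF lim(1) du] by simp
  have v': "(\<lambda>n. v (Suc (Suc (r n)))) \<longlonglongrightarrow> vs" using tendsto_diff[OF lim(2) dv] by simp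
  have b': "(\<lambda>n. ubar (Suc (r n))) \<longlonglongrightarrow> us" using tendsto_diff[OF lim(1) db] by simp
  have h': "(\<lambda>n. grad (v (Suc (Suc (r n))))) \<longlonglongrightarrow> grad vs"
    using continuous_on_tendsto_compose[OF grad_cont v'] by simp
  have G_le: "G us \<le> ereal (g x + K (x - us) \<bullet> vs)" if x: "G x \<noteq> \<infinity>" for x
  proof (rule lsc_le_limit[OF G(2) lim(1)])
    show "(\<lambda>n. ereal (g x + norm (u (Suc (Suc (r n))) - u (Suc (Suc (Suc (r n))))) * norm (x - u (Suc (Suc (Suc (r n))))) / c
        + K (x - u (Suc (Suc (Suc (r n))))) \<bullet> v (Suc (Suc (Suc (r n)))))) \<longlonglongrightarrow> ereal (g x + K (x - us) \<bullet> vs)"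
      by (rule tendsto_eq_intros refl K_tendsto u' lim | use c in force)+
    show "G (u (Suc (Suc (Suc (r n))))) \<le> ereal (g x + norm (u (Suc (Suc (r n))) - u (Suc (Suc (Suc (r n))))) * norm (x - u (Suc (Suc (Suc (r n))))) / c
        + K (x - u (Suc (Suc (Suc (r n))))) \<bullet> v (Suc (Suc (Suc (r n)))))" for n
      using g_iterate_le[OF x, of "Suc (Suc (r n))"] proper_finite[OF G(1) u_dom, of "Suc (Suc (r n))"]
      by (metis ereal_less_eq(3))
  qed
  have F_le: "F vs \<le> ereal (f y - (K us - grad vs) \<bullet> (y - vs))" if y: "F y \<noteq> \<infinity>" for y
  proof (rule lsc_le_limit[OF F(2) lim(2)])
    let ?b = "\<lambda>n. f y + norm (v (Suc (Suc (r n))) - v (Suc (Suc (Suc (r n))))) * norm (y - v (Suc (Suc (Suc (r n))))) / (\<beta> * c)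
           - (K (ubar (Suc (r n))) - grad (v (Suc (Suc (r n))))) \<bullet> (y - v (Suc (Suc (Suc (r n)))))"
    show "(\<lambda>n. ereal (?b n)) \<longlonglongrightarrow> ereal (f y - (K us - grad vs) \<bullet> (y - vs))"
      by (rule tendsto_eq_intros refl K_tendsto u' v' b' h' lim | use c \<beta> in force)+
    show "F (v (Suc (Suc (Suc (r n))))) \<le> ereal (?b n)" for n
      using f_iterate_le[OF y, of "Suc (r n)"] proper_finite[OF F(1) v_dom, of "Suc (r n)"]
      by (metis ereal_less_eq(3))
  qed
  have dom: "G us \<noteq> \<infinity>" "F vs \<noteq> \<infinity>"
    using G_le[OF saddle_gaps(1)[OF sp]] F_le[OF saddle_gaps(2)[OF sp]] by auto
  show ?thesis
    unfolding saddle_point_iff[OF K G(1) F(1)]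
  proof (intro conjI allI impI dom)
    fix x assume "G x \<noteq> \<infinity>"
    from G_le[OF this] have "g us \<le> g x + K (x - us) \<bullet> vs"
      by (subst (asm) proper_finite[OF G(1) dom(1)]) simp
    then show "0 \<le> g x - g us + K (x - us) \<bullet> vs" by simp
  next
    fix y assume "F y \<noteq> \<infinity>"
    from F_le[OF this] have "f vs \<le> f y - (K us - grad vs) \<bullet> (y - vs)"
      by (subst (asm) proper_finite[OF F(1) dom(2)]) simp
    then show "0 \<le> f y + H y - (f vs + H vs) - K us \<bullet> (y - vs)"
      using H_above[of vs y] by (simp add: inner_diff_left)
  qed
qed

lemma P_le:
  assumes "G uh \<noteq> \<infinity>"
  shows "P uh vh (u (Suc n)) \<le> norm (u n - u (Suc n)) * norm (uh - u (Suc n)) / c + K (uh - u (Suc n)) \<bullet> (v (Suc n) - vh)"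
proof -
  have "K (u (Suc n) - uh) \<bullet> vh = - (K (uh - u (Suc n)) \<bullet> vh)"
    by (simp add: linear_diff[OF K] inner_diff_left)
  then show ?thesis
    using g_iterate_le[OF assms, of n] by (simp add: P_def inner_diff_right)
qed

text \<open>The subsequence \<open>r\<close> allows two uses: at a cluster point, and, with the identity for \<open>r\<close>, after
convergence of the whole sequence is known.\<close>

lemma P_tendsto_0:
  assumes sp: "saddle_point K G F H uh vh" and r: "strict_mono (r :: nat \<Rightarrow> nat)"
    and lim: "(\<lambda>n. u (Suc (Suc (Suc (r n))))) \<longlonglongrightarrow> uh" "(\<lambda>n. v (Suc (Suc (Suc (r n))))) \<longlonglongrightarrow> vh"
  shows "(\<lambda>n. P uh vh (u (Suc (Suc (Suc (r n)))))) \<longlonglongrightarrow> 0"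
proof (rule tendsto_sandwich[OF _ _ tendsto_const])
  have u': "(\<lambda>n. u (Suc (Suc (r n)))) \<longlonglongrightarrow> uh"
    using tendsto_diff[OF lim(1) LIMSEQ_subseq_LIMSEQ[OF increments_tendsto_0[OF sp] r, unfolded o_def]] by simp
  show "(\<lambda>n. norm (u (Suc (Suc (r n))) - u (Suc (Suc (Suc (r n))))) * norm (uh - u (Suc (Suc (Suc (r n))))) / c
          + K (uh - u (Suc (Suc (Suc (r n))))) \<bullet> (v (Suc (Suc (Suc (r n)))) - vh)) \<longlonglongrightarrow> 0"
    by (rule tendsto_eq_intros refl K_tendsto u' lim | use c in force)+
qed (auto intro!: always_eventually P_le saddle_gaps[OF sp] u_dom)

text \<open>Boundedness yields a cluster point, which is a saddle point. Its own energy is monotone and tends to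
\<open>0\<close> along a subsequence, and so it tends to \<open>0\<close>; this excludes a second cluster point.\<close>

lemma iterates_converge:
  assumes sp: "saddle_point K G F H u0 v0"
  obtains uh vh where "saddle_point K G F H uh vh" "u \<longlonglongrightarrow> uh" "v \<longlonglongrightarrow> vh"
    "(\<lambda>n. P uh vh (u n)) \<longlonglongrightarrow> 0" "(\<lambda>n. D uh vh (v n)) \<longlonglongrightarrow> 0"
proof -
  (* Boundedness from the energy of the given saddle point yields a cluster point, which is then
     used as a new saddle point. *)
  define w where "w = (\<lambda>n. (u (Suc (Suc (Suc n))), v (Suc (Suc (Suc n)))))"
  define E where "E = energy u0 v0 1"
  have E: "(norm (u0 - u (Suc (Suc n))))\<^sup>2 / 2 + (norm (v0 - v (Suc (Suc n))))\<^sup>2 / (2 * \<beta>) \<le> E" for n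
    using energy_ge_distances[OF sp, of n] decseqD[OF energy_decseq[OF sp], of 0 n] by (simp add: E_def)
  have "norm (u0 - u (Suc (Suc n))) \<le> sqrt (2 * E)" "norm (v0 - v (Suc (Suc n))) \<le> sqrt (2 * \<beta> * E)" for n
  proof -
    have nn: "0 \<le> (norm (u0 - u (Suc (Suc n))))\<^sup>2 / 2" "0 \<le> (norm (v0 - v (Suc (Suc n))))\<^sup>2 / (2 * \<beta>)"
      using \<beta> by auto
    show "norm (u0 - u (Suc (Suc n))) \<le> sqrt (2 * E)"
      using E[of n] nn by (intro real_le_rsqrt) linarith
    have "(norm (v0 - v (Suc (Suc n))))\<^sup>2 / (2 * \<beta>) \<le> E" using E[of n] nn by linarith
    then show "norm (v0 - v (Suc (Suc n))) \<le> sqrt (2 * \<beta> * E)"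
      using \<beta> by (intro real_le_rsqrt) (simp add: field_simps)
  qed
  then have "range w \<subseteq> cball u0 (sqrt (2 * E)) \<times> cball v0 (sqrt (2 * \<beta> * E))"
    by (auto simp: w_def dist_norm)
  then have "bounded (range w)"
    by (rule bounded_subset[rotated]) (auto intro: bounded_Times)
  then obtain l r where r: "strict_mono (r :: nat \<Rightarrow> nat)" and l: "(w \<circ> r) \<longlonglongrightarrow> l"
    using bounded_imp_convergent_subsequence by blast
  obtain uh vh where "l = (uh, vh)" by (cases l)
  with l have lim: "(\<lambda>n. u (Suc (Suc (Suc (r n))))) \<longlonglongrightarrow> uh" "(\<lambda>n. v (Suc (Suc (Suc (r n))))) \<longlonglongrightarrow> vh"
    using tendsto_fst[OF l] tendsto_snd[OF l] by (auto simp: w_def o_def)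
  have sph: "saddle_point K G F H uh vh"
    by (rule cluster_point_is_saddle[OF sp r lim])
  have u'': "(\<lambda>n. u (Suc (Suc (Suc (Suc (r n)))))) \<longlonglongrightarrow> uh"
    using tendsto_add[OF lim(1) LIMSEQ_subseq_LIMSEQ[OF LIMSEQ_Suc[OF increments_tendsto_0[OF sp]] r, unfolded o_def]] by simp
  have v'': "(\<lambda>n. v (Suc (Suc (Suc (Suc (r n)))))) \<longlonglongrightarrow> vh"
    using tendsto_add[OF lim(2) LIMSEQ_subseq_LIMSEQ[OF LIMSEQ_Suc[OF remainders_tendsto_0(2)[OF sp]] r, unfolded o_def]] by simp
  have Pr: "(\<lambda>n. P uh vh (u (Suc (Suc (Suc (r n)))))) \<longlonglongrightarrow> 0"
    by (rule P_tendsto_0[OF sph r lim])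
  (* The weights of the gap in the energy are bounded, so all three parts of the energy vanish
     along the subsequence. *)
  have wP: "(\<lambda>n. \<tau> (Suc (Suc (Suc (r n)))) * (1 + \<theta> (Suc (Suc (Suc (r n))))) * P uh vh (u (Suc (Suc (Suc (r n)))))) \<longlonglongrightarrow> 0"
  proof (rule tendsto_sandwich[OF _ _ tendsto_const])
    show "(\<lambda>n. T * 3 * P uh vh (u (Suc (Suc (Suc (r n)))))) \<longlonglongrightarrow> 0"
      using tendsto_mult_right_zero[OF Pr] .
    have "\<tau> (Suc n) * (1 + \<theta> (Suc n)) \<le> T * 3" for n
      using \<tau>_le[of n] \<theta>_le_2[of "Suc n"] \<tau>_pos[of "Suc n"] \<theta>_pos[of "Suc n"] by (intro mult_mono) auto
    then show "\<forall>\<^sub>F n in sequentially. \<tau> (Suc (Suc (Suc (r n)))) * (1 + \<theta> (Suc (Suc (Suc (r n))))) * P uh vh (u (Suc (Suc (Suc (r n)))))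
        \<le> T * 3 * P uh vh (u (Suc (Suc (Suc (r n)))))"
      by (intro always_eventually allI mult_right_mono saddle_gaps(3)[OF sph] u_dom)
    show "\<forall>\<^sub>F n in sequentially. 0 \<le> \<tau> (Suc (Suc (Suc (r n)))) * (1 + \<theta> (Suc (Suc (Suc (r n))))) * P uh vh (u (Suc (Suc (Suc (r n)))))"
      using \<tau>_pos \<theta>_pos
      by (intro always_eventually allI mult_nonneg_nonneg saddle_gaps(3)[OF sph] u_dom) (auto intro!: less_imp_le add_pos_pos)
  qed
  have Er: "(\<lambda>n. energy uh vh (Suc (Suc (Suc (r n))))) \<longlonglongrightarrow> 0"
    unfolding energy_def by (rule tendsto_eq_intros refl u'' v'' wP | use \<beta> in force)+
  have E0: "(\<lambda>n. energy uh vh (Suc n)) \<longlonglongrightarrow> 0"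
  proof -
    obtain L where L: "(\<lambda>n. energy uh vh (Suc n)) \<longlonglongrightarrow> L"
      using energy_limit[OF sph] .
    have "(\<lambda>n. energy uh vh (Suc (Suc (Suc (r n))))) \<longlonglongrightarrow> L"
      using LIMSEQ_subseq_LIMSEQ[OF LIMSEQ_Suc[OF LIMSEQ_Suc[OF L]] r] by (simp add: o_def)
    with Er have "L = 0" using LIMSEQ_unique by blast
    with L show ?thesis by simp
  qed
  have sq: "X \<longlonglongrightarrow> x" if "\<And>n. (norm (x - X (Suc (Suc n))))\<^sup>2 \<le> a * energy uh vh (Suc n)"
    for a and X :: "nat \<Rightarrow> 'b::real_normed_vector" and x
  proof -
    have "(\<lambda>n. (norm (x - X (Suc (Suc n))))\<^sup>2) \<longlonglongrightarrow> 0"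
      by (rule tendsto_sandwich[OF _ _ tendsto_const tendsto_mult_right_zero[OF E0, of a]]) (use that in auto)
    then have "(\<lambda>n. sqrt ((norm (x - X (Suc (Suc n))))\<^sup>2)) \<longlonglongrightarrow> sqrt 0" by (rule tendsto_real_sqrt)
    then have "(\<lambda>n. norm (X (Suc (Suc n)) - x)) \<longlonglongrightarrow> 0" by (simp add: norm_minus_commute)
    then have "(\<lambda>n. X (Suc (Suc n))) \<longlonglongrightarrow> x"
      using LIM_zero_cancel tendsto_norm_zero_iff by blast
    then show ?thesis by (simp add: LIMSEQ_imp_Suc)
  qed
  have ulim: "u \<longlonglongrightarrow> uh"
  proof (rule sq[of _ _ 2])
    fix n
    have "0 \<le> (norm (vh - v (Suc (Suc n))))\<^sup>2 / (2 * \<beta>)" using \<beta> by simp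
    then show "(norm (uh - u (Suc (Suc n))))\<^sup>2 \<le> 2 * energy uh vh (Suc n)"
      using energy_ge_distances[OF sph, of n] by simp
  qed
  have vlim: "v \<longlonglongrightarrow> vh"
  proof (rule sq[of _ _ "2 * \<beta>"])
    fix n
    have "0 \<le> (norm (uh - u (Suc (Suc n))))\<^sup>2 / 2" by simp
    then have "(norm (vh - v (Suc (Suc n))))\<^sup>2 / (2 * \<beta>) \<le> energy uh vh (Suc n)"
      using energy_ge_distances[OF sph, of n] by linarith
    then show "(norm (vh - v (Suc (Suc n))))\<^sup>2 \<le> 2 * \<beta> * energy uh vh (Suc n)"
      using \<beta> by (simp add: field_simps)
  qed
  have "(\<lambda>n. P uh vh (u (Suc (Suc (Suc n))))) \<longlonglongrightarrow> 0"
    by (rule P_tendsto_0[OF sph strict_mono_id[unfolded id_def]])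
       (intro LIMSEQ_Suc ulim vlim)+
  then have "(\<lambda>n. P uh vh (u n)) \<longlonglongrightarrow> 0"
    by (intro LIMSEQ_imp_Suc[of "\<lambda>n. P uh vh (u n)"] LIMSEQ_imp_Suc[of "\<lambda>n. P uh vh (u (Suc n))"]
        LIMSEQ_imp_Suc[of "\<lambda>n. P uh vh (u (Suc (Suc n)))"])
  moreover have "(\<lambda>n. D uh vh (v n)) \<longlonglongrightarrow> 0"
    using remainders_tendsto_0(4)[OF sph]
    by (intro LIMSEQ_imp_Suc[of "\<lambda>n. D uh vh (v n)"] LIMSEQ_imp_Suc[of "\<lambda>n. D uh vh (v (Suc n))"]
        LIMSEQ_imp_Suc[of "\<lambda>n. D uh vh (v (Suc (Suc n)))"])
  ultimately show ?thesis
    using that[OF sph ulim vlim] by blast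
qed

end

section \<open>Convergence of the algorithm with linesearch\<close>

text \<open>It remains to check that a run satisfies the assumptions of the locale, and that from the second
iterate on the extended real gap is the sum of the two real ones.\<close>

theorem theorem3p4:
  fixes K :: "'u::euclidean_space \<Rightarrow> 'v::euclidean_space"
    and G :: "'u \<Rightarrow> ereal" and F :: "'v \<Rightarrow> ereal" and H :: "'v \<Rightarrow> real"
    and param :: "'p ls_param_scheme" and LS :: "('p, 'u, 'v) linesearch"
    and \<gamma> \<delta>K :: real
    and \<alpha> \<tau> :: "nat \<Rightarrow> real" and u :: "nat \<Rightarrow> 'u" and v :: "nat \<Rightarrow> 'v"
  assumes K: "linear K" "K \<noteq> (\<lambda>_. 0)"
    and F: "proper F" "lsc F" "ereal_convex F"
    and G: "proper G" "lsc G" "ereal_convex G"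
    and H: "H differentiable_on UNIV" "convex_on UNIV H" "locally_lipschitz (gradient H)"
    and param: "0 < ls_beta param" "0 < ls_delta param" "ls_delta param < 1"
    and \<gamma>: "0 < \<gamma>" "\<gamma> < 1"
    and \<delta>K: "0 < \<delta>K" "\<delta>K < 1" "\<delta>K + ls_delta param < 1"
    and \<tau>0: "0 < \<tau> 0"
    and A: "abstract_linesearch H param LS"
    and run: "pd_linesearch_run K G F H param LS \<gamma> \<delta>K \<alpha> \<tau> u v"
    and B: "\<exists>c>0. \<forall>k. c \<le> \<tau> k"
    and saddle: "\<exists>uh vh. saddle_point K G F H uh vh"
  shows "\<exists>uh vh. saddle_point K G F H uh vh \<and>
           (\<lambda>k. (u k, v k)) \<longlonglongrightarrow> (uh, vh) \<and>
           (\<lambda>k. primal_dual_gap K G F H uh vh (u k) (v k)) \<longlonglongrightarrow> 0"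
proof -
  define \<beta> where "\<beta> = ls_beta param"
  define \<delta> where "\<delta> = ls_delta param"
  define \<rho> where "\<rho> = sqrt \<delta>K / sqrt \<beta>"
  define \<theta> where "\<theta> = theta \<tau>"
  obtain c where c: "0 < c" "\<And>k. c \<le> \<tau> k" using B by blast
  have \<tau>_pos: "0 < \<tau> k" for k using c(1) c(2)[of k] by linarith
  have \<beta>: "0 < \<beta>" using param by (simp add: \<beta>_def)
  have onorm_pos: "0 < onorm K"
    using onorm_pos_lt[of K] K by (auto simp: linear_linear)
  have \<theta>_Suc: "\<theta> (Suc n) = \<tau> (Suc n) / \<tau> n" for n by (simp add: \<theta>_def theta_def)
  have \<theta>_pos: "0 < \<theta> n" for n using \<tau>_pos by (cases n) (auto simp: \<theta>_def theta_def)
  have u_prox: "u (Suc n) = prox (\<tau> n) G (u n - \<tau> n *\<^sub>R adjoint K (v (Suc n)))" for n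
    using run unfolding pd_linesearch_run_def by (auto dest: spec[of _ "Suc n"])
  have \<alpha>: "1 \<le> \<alpha> (Suc n)" "\<alpha> (Suc n) \<le> sqrt (1 + \<gamma> * \<theta> n)" for n
    using run unfolding pd_linesearch_run_def by (auto simp: \<theta>_def dest: spec[of _ "Suc n"])
  have LS: "LS param (min (\<rho> / onorm K) (\<tau> n * \<alpha> (Suc n))) (\<tau> n) (u n) (u (Suc n)) (v (Suc n))
      = (\<tau> (Suc n), v (Suc (Suc n)))" for n
    using run unfolding pd_linesearch_run_def
    by (auto simp: Let_def \<rho>_def \<beta>_def dest!: spec[of _ "Suc n"])
  have v_prox: "v (Suc (Suc n)) = prox (\<beta> * \<tau> (Suc n)) F (v (Suc n) + (\<beta> * \<tau> (Suc n)) *\<^sub>R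
      (K (u (Suc n) + \<theta> (Suc n) *\<^sub>R (u (Suc n) - u n)) - gradient H (v (Suc n))))" for n
    using run unfolding pd_linesearch_run_def
    by (auto simp: Let_def \<theta>_def \<beta>_def dest!: spec[of _ "Suc n"])
  (* The guarantees of the linesearch hold for positive inputs only. *)
  have init_pos: "0 < min (\<rho> / onorm K) (\<tau> n * \<alpha> (Suc n))" for n
    using \<alpha>(1)[of n] \<tau>_pos[of n] onorm_pos \<beta> \<delta>K(1) by (simp add: \<rho>_def)
  have ls: "\<tau> (Suc n) \<le> min (\<rho> / onorm K) (\<tau> n * \<alpha> (Suc n))"
    "\<tau> (Suc n) * (H (v (Suc (Suc n))) - H (v (Suc n)) - gradient H (v (Suc n)) \<bullet> (v (Suc (Suc n)) - v (Suc n)))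
        \<le> \<delta> / (2 * \<beta>) * (norm (v (Suc (Suc n)) - v (Suc n)))\<^sup>2" for n
    using A init_pos[of n] \<tau>_pos[of n] LS[of n] unfolding abstract_linesearch_def \<beta>_def \<delta>_def by blast+
  have bt: "0 < \<beta> * \<tau> n" for n using \<beta> \<tau>_pos by simp
  interpret pd_iteration K G F H "gradient H" \<beta> \<delta> \<rho> c "\<rho> / onorm K" \<tau> \<theta> u v
  proof (rule pd_iteration.intro)
    show "H z + gradient H z \<bullet> (y - z) \<le> H y" for z y by (rule convex_above_gradient[OF H(1,2)])
    show "\<rho>\<^sup>2 < (1 - \<delta>) / \<beta>"
      using \<delta>K \<beta> by (simp add: \<rho>_def \<delta>_def power_divide divide_strict_right_mono)
    show "\<tau> (Suc n) \<le> \<rho> / onorm K" for n using ls(1)[of n] by simp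
    then show "\<tau> (Suc n) * onorm K \<le> \<rho>" for n using onorm_pos by (simp add: pos_le_divide_eq)
    show "(\<theta> (Suc n))\<^sup>2 \<le> 1 + \<theta> n" for n
    proof -
      have "\<theta> (Suc n) \<le> \<alpha> (Suc n)"
        using ls(1)[of n] \<tau>_pos[of n] by (simp add: \<theta>_Suc divide_le_eq mult.commute)
      also have "\<dots> \<le> sqrt (1 + \<gamma> * \<theta> n)" by (rule \<alpha>(2))
      finally have "(\<theta> (Suc n))\<^sup>2 \<le> (sqrt (1 + \<gamma> * \<theta> n))\<^sup>2"
        using \<theta>_pos[of "Suc n"] by (intro power_mono) auto
      also have "\<dots> = 1 + \<gamma> * \<theta> n" using \<gamma>(1) \<theta>_pos[of n] by simp
      also have "\<dots> \<le> 1 + \<theta> n" using \<gamma>(2) \<theta>_pos[of n] by simp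
      finally show ?thesis .
    qed
    show "G (u (Suc n)) \<noteq> \<infinity>" for n
      unfolding u_prox by (rule prox_finite[OF G \<tau>_pos])
    show "F (v (Suc (Suc n))) \<noteq> \<infinity>" for n
      unfolding v_prox by (rule prox_finite[OF F bt])
    show "(u n - \<tau> n *\<^sub>R adjoint K (v (Suc n)) - u (Suc n)) \<bullet> (x - u (Suc n))
        \<le> \<tau> n * (real_of_ereal (G x) - real_of_ereal (G (u (Suc n))))" if "G x \<noteq> \<infinity>" for x n
      using prox_variational_inequality[OF G \<tau>_pos that] by (simp add: u_prox[of n])
    show "(v (Suc n) + (\<beta> * \<tau> (Suc n)) *\<^sub>R (K (u (Suc n) + \<theta> (Suc n) *\<^sub>R (u (Suc n) - u n)) - gradient H (v (Suc n)))
         - v (Suc (Suc n))) \<bullet> (y - v (Suc (Suc n)))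
        \<le> \<beta> * \<tau> (Suc n) * (real_of_ereal (F y) - real_of_ereal (F (v (Suc (Suc n)))))" if "F y \<noteq> \<infinity>" for y n
      unfolding v_prox[of n] by (rule prox_variational_inequality[OF F bt that])
    show "\<tau> (Suc n) * (H (v (Suc (Suc n))) - H (v (Suc n)) - gradient H (v (Suc n)) \<bullet> (v (Suc (Suc n)) - v (Suc n)))
        \<le> \<delta> / (2 * \<beta>) * (norm (v (Suc (Suc n)) - v (Suc n)))\<^sup>2" for n
      by (rule ls(2))
  qed (use K F G c \<beta> param \<theta>_Suc locally_lipschitz_continuous[OF H(3)] in \<open>auto simp: \<delta>_def \<theta>_def theta_def\<close>)
  obtain uh vh where sp: "saddle_point K G F H uh vh" and lim: "u \<longlonglongrightarrow> uh" "v \<longlonglongrightarrow> vh"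
    and gaps: "(\<lambda>n. P uh vh (u n)) \<longlonglongrightarrow> 0" "(\<lambda>n. D uh vh (v n)) \<longlonglongrightarrow> 0"
    using saddle iterates_converge by metis
  have gap_eq: "primal_dual_gap K G F H uh vh (u n) (v n) = ereal (P uh vh (u n) + D uh vh (v n))" if "2 \<le> n" for n
  proof -
    obtain m where n: "n = Suc (Suc m)" using \<open>2 \<le> n\<close> by (metis Suc_le_D numeral_2_eq_2 Suc_le_mono)
    have eqs: "G (u n) = ereal (g (u n))" "F (v n) = ereal (f (v n))" "G uh = ereal (g uh)" "F vh = ereal (f vh)"
      unfolding n by (rule proper_finite[OF G(1)] proper_finite[OF F(1)] u_dom v_dom saddle_gaps(1,2)[OF sp])+
    have "adjoint K vh \<bullet> (u n - uh) = K (u n - uh) \<bullet> vh"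
      using adjoint_works[OF K(1), of "u n - uh" vh] by (simp add: inner_commute)
    then show ?thesis
      unfolding primal_dual_gap_def primal_gap_def dual_gap_def P_def D_def
      by (subst eqs(1), subst eqs(2), subst eqs(3), subst eqs(4)) simp
  qed
  have "(\<lambda>n. ereal (P uh vh (u n) + D uh vh (v n))) \<longlonglongrightarrow> ereal (0 + 0)"
    by (intro tendsto_ereal tendsto_add gaps)
  then have "(\<lambda>n. primal_dual_gap K G F H uh vh (u n) (v n)) \<longlonglongrightarrow> ereal (0 + 0)"
    by (rule Lim_transform_eventually) (use gap_eq in \<open>auto intro: eventually_sequentiallyI[of 2]\<close>)
  then show ?thesis
    using sp tendsto_Pair[OF lim] by (auto simp: zero_ereal_def)
qed

end
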